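(* Let $b\geqslant2$ be an integer, let $\alpha_1,\alpha_2>0$ and let $\eta>1$. Let $\{l_i\}_{i\geqslant1}$ be an increasing sequence of positive integers satisfying $$\lim_{i\to+\infty}\frac{l_{i-1}}{l_i}=0,$$ and such that $N_i:=l_{i+1}-\lfloor l_i\eta\rfloor-1\geqslant0$ for all $i\geqslant1$. For each $i\geqslant1$ let $\nu_i$ be the finite word $$\nu_i=\begin{cases}0^{\lfloor l_i\eta\rfloor-l_i}\,1\,(01)^{\lfloor N_i/2\rfloor}, & \text{if } N_i \text{ is even},\\ 0^{\lfloor l_i\eta\rfloor-l_i}\,1\,(01)^{\lfloor N_i/2\rfloor}\,1, & \text{if } N_i\text{ is odd}.\end{cases}$$ Let $y$ be the real number whose $b$-ary expansion is the infinite concatenation $\nu_1\nu_2\nu_3\cdots$. Then the bivariate multifractal spectrum of the Lévy function $L_{\alpha_1}^b$ and the translated Lévy function $L_{\alpha_2}^{b,y}$ is $$\mathcal{D}_{L_{\alpha_1}^b,L_{\alpha_2}^{b,y}}(H_1,H_2)=\begin{cases}\min\left\{\dfrac{H_1}{\alpha_1},\dfrac{H_2}{\alpha_2}\right\}, & \text{if } (H_1,H_2)\in[0,\alpha_1]\times[0,\alpha_2],\\[2ex] -\infty, & \text{otherwise}.\end{cases}$$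
   Context: Words and expansions: letters are in $\{0,1,\dots,b-1\}$; for a word $w$ and an integer $m\geqslant0$, $w^m$ is the concatenation of $m$ copies of $w$; a real number $x\in[0,1)$ has $b$-ary expansion $\varepsilon_1\varepsilon_2\cdots$ if $x=\sum_{i\geqslant1}\varepsilon_ib^{-i}$. Saw-tooth function: $\{x\}=x-\lfloor x\rfloor-\tfrac12$ if $x\notin\mathbb{Z}$ and $\{x\}=0$ if $x\in\mathbb{Z}$. For $\alpha>0$, an integer $b\geqslant2$ and $y\in\mathbb{R}$, the Lévy function and the translated Lévy function are, for $x\in\mathbb{R}$, $$L_\alpha^b(x)=\sum_{i=1}^\infty\frac{\{b^ix\}}{b^{\alpha i}},\qquad L_\alpha^{b,y}(x)=\sum_{i=1}^\infty\frac{\{b^i(x-y)\}}{b^{\alpha i}}=L_\alpha^b(x-y).$$ Hölder exponent: for a locally bounded $f:\mathbb{R}\to\mathbb{R}$, $\alpha>0$ and $x_0\in\mathbb{R}$, $f\in C^\alpha(x_0)$ if there exist $C>0$, $r>0$ and a polynomial $P$ with $\deg P<\alpha$ such that $|f(x)-P(x-x_0)|\leqslant C|x-x_0|^\alpha$ for all $x\in[x_0-r,x_0+r]$. The Hölder exponent is $h_f(x_0)=\sup\{\alpha\geqslant0: f\in C^\alpha(x_0)\}$ (equal to $0$ if $f\in C^\alpha(x_0)$ for no $\alpha>0$). Bivariate multifractal spectrum: for functions $f,g$ and reals $H_1,H_2$, $\mathcal{D}_{f,g}(H_1,H_2)=\dim_H\{x\in\mathbb{R}: h_f(x)=H_1,\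 h_g(x)=H_2\}$, where $\dim_H$ is the Hausdorff dimension, with the convention $\dim_H(\emptyset)=-\infty$. *)

theory Defs
  imports
    "HOL-Analysis.Analysis"
    "HOL-Library.Stream"
    "HOL-Computational_Algebra.Polynomial"
begin

section \<open>Words and expansions\<close>

definition word_power :: "'a list \<Rightarrow> nat \<Rightarrow> 'a list" where
  "word_power w m = concat (replicate m w)"

text \<open>Streams are indexed from 0, so the digit \<open>s !! i\<close> has weight \<open>b ^ -(i + 1)\<close>.\<close>

definition has_expansion :: "nat \<Rightarrow> real \<Rightarrow> nat stream \<Rightarrow> bool" where
  "has_expansion b x s \<longleftrightarrow> 0 \<le> x \<and> x < 1 \<and> (\<forall>i. s !! i < b) \<and>
     (\<lambda>i. real (s !! i) / real b ^ Suc i) sums x"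

section \<open>Levy functions\<close>

definition sawtooth :: "real \<Rightarrow> real" where
  "sawtooth x = (if x \<in> \<int> then 0 else x - of_int \<lfloor>x\<rfloor> - 1 / 2)"

definition levy :: "nat \<Rightarrow> real \<Rightarrow> real \<Rightarrow> real" where
  "levy b \<alpha> x = (\<Sum>i. sawtooth (real b ^ Suc i * x) / real b powr (\<alpha> * real (Suc i)))"

definition levy_translated :: "nat \<Rightarrow> real \<Rightarrow> real \<Rightarrow> real \<Rightarrow> real" where
  "levy_translated b \<alpha> y x =
     (\<Sum>i. sawtooth (real b ^ Suc i * (x - y)) / real b powr (\<alpha> * real (Suc i)))"

section \<open>Pointwise Hoelder regularity\<close>

definition holder_at :: "(real \<Rightarrow> real) \<Rightarrow> real \<Rightarrow> real \<Rightarrow> bool" where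
  "holder_at f \<alpha> x0 \<longleftrightarrow> (\<exists>C>0. \<exists>r>0. \<exists>P :: real poly. real (degree P) < \<alpha> \<and>
     (\<forall>x\<in>{x0 - r..x0 + r}. \<bar>f x - poly P (x - x0)\<bar> \<le> C * \<bar>x - x0\<bar> powr \<alpha>))"

text \<open>The inserted 0 is the convention for functions that are in no \<open>C\<^sup>\<alpha>(x0)\<close> with \<open>\<alpha> > 0\<close>.\<close>

definition holder_exponent :: "(real \<Rightarrow> real) \<Rightarrow> real \<Rightarrow> ereal" where
  "holder_exponent f x0 = Sup (insert 0 {ereal \<alpha> | \<alpha>. \<alpha> > 0 \<and> holder_at f \<alpha> x0})"

section \<open>Hausdorff dimension\<close>

text \<open>Since \<open>0 powr 0 = 0\<close> here, the exponent 0 is treated separately, so that the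
  0-dimensional Hausdorff measure is the counting measure.\<close>

definition diameter_power :: "real \<Rightarrow> 'a::metric_space set \<Rightarrow> ennreal" where
  "diameter_power s U =
     (if U = {} then 0 else if s = 0 then 1 else ennreal (diameter U powr s))"

text \<open>The \<open>diameter\<close> of an unbounded set is unspecified, so boundedness is required explicitly.\<close>

definition hausdorff_premeasure :: "real \<Rightarrow> real \<Rightarrow> 'a::metric_space set \<Rightarrow> ennreal" where
  "hausdorff_premeasure s \<delta> A =
     (INF U\<in>{U :: nat \<Rightarrow> 'a set. A \<subseteq> (\<Union>i. U i) \<and> (\<forall>i. bounded (U i) \<and> diameter (U i) \<le> \<delta>)}.
        \<Sum>i. diameter_power s (U i))"

definition hausdorff_measure :: "real \<Rightarrow> 'a::metric_space set \<Rightarrow> ennreal" where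
  "hausdorff_measure s A = (SUP \<delta>\<in>{0<..}. hausdorff_premeasure s \<delta> A)"

definition hausdorff_dim :: "'a::metric_space set \<Rightarrow> ereal" where
  "hausdorff_dim A =
     (if A = {} then - \<infinity> else Inf {ereal s | s. s \<ge> 0 \<and> hausdorff_measure s A = 0})"

definition bivariate_spectrum ::
  "(real \<Rightarrow> real) \<Rightarrow> (real \<Rightarrow> real) \<Rightarrow> real \<Rightarrow> real \<Rightarrow> ereal" where
  "bivariate_spectrum f g H1 H2 =
     hausdorff_dim {x. holder_exponent f x = ereal H1 \<and> holder_exponent g x = ereal H2}"

section \<open>The words defining the translation parameter\<close>

definition gap :: "(nat \<Rightarrow> nat) \<Rightarrow> real \<Rightarrow> nat \<Rightarrow> int" where
  "gap l \<eta> i = int (l (i + 1)) - \<lfloor>real (l i) * \<eta>\<rfloor> - 1"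

definition block :: "(nat \<Rightarrow> nat) \<Rightarrow> real \<Rightarrow> nat \<Rightarrow> nat list" where
  "block l \<eta> i =
     word_power [0] (nat (\<lfloor>real (l i) * \<eta>\<rfloor> - int (l i))) @ [1] @
     word_power [0, 1] (nat \<lfloor>real_of_int (gap l \<eta> i) / 2\<rfloor>) @
     (if even (gap l \<eta> i) then [] else [1])"

text \<open>The words are numbered from 1; the value \<open>l 0\<close> is never used.\<close>

definition blocks_concat :: "(nat \<Rightarrow> nat) \<Rightarrow> real \<Rightarrow> nat stream" where
  "blocks_concat l \<eta> = flat (smap (block l \<eta>) (fromN 1))"

end

theory Submission
  imports Defs "HOL-Library.Discrete_Functions"
begin

text \<open>
  The Levy function has a jump of size about \<open>b\<close> to the power \<open>- \<alpha> n\<close> at the \<open>b\<close>-adic points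
  of level \<open>n\<close> and is affine between the jumps of each level, so its Hoelder exponent at \<open>x\<close> is
  \<open>\<alpha> u\<close>, where \<open>1 / u\<close> is the exponent of approximation of \<open>x\<close> by \<open>b\<close>-adic numbers. The spectrum is
  therefore the dimension of the set of \<open>x\<close> for which \<open>x\<close> and \<open>x - y\<close> have the exponents \<open>1 / u\<close> and
  \<open>1 / v\<close>. The upper bound \<open>min u v\<close> comes from covering by \<open>b\<close>-adic intervals.

  For the lower bound, \<open>y\<close> has digits \<open>0101\<dots>\<close> on stretches whose end is arbitrarily many times larger
  than their beginning. On selected parts of such stretches the digits of \<open>x\<close> copy alternately those of
  0 and of \<open>y\<close>; there only one of \<open>x\<close>, \<open>x - y\<close> is close to \<open>b\<close>-adic numbers, because \<open>y\<close> is not. Short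
  words inserted at the positions \<open>k\<^sup>2\<close> prevent any other good approximation, and all
  remaining digits are free. Writing the digits of \<open>t \<in> [0, 1)\<close> into the free positions turns a cover
  of the resulting set into a cover of \<open>[0, 1)\<close>, which bounds its Hausdorff measure from below.
\<close>

section \<open>Digit expansions\<close>

text \<open>A number copying a model from digit A to digit C is approximated at level A with
  exponent C/A, so rate u asks for runs with C/A near 1/u. Such a run costs C - A digits, and at its
  end a proportion of about u of all digits is free. The runs for u and for v lie so far apart that
  all earlier ones are negligible when a run begins; their costs never add up, and the smallest
  density of free digits is min u v. A run for one number must not help the other: where y has long
  blocks of zeros, copying 0 also copies y. Runs are therefore placed only where y reads 0101...,
  and the condition on l_(i-1)/l_i makes these stretches long enough for every ratio C/A, including
  the unbounded ones that the rates u = 0 or v = 0 require.\<close>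

definition digit_sum :: "nat \<Rightarrow> (nat \<Rightarrow> nat) \<Rightarrow> real" where
  "digit_sum b w = (\<Sum>i. real (w i) / real b ^ Suc i)"

primrec digit_prefix :: "nat \<Rightarrow> (nat \<Rightarrow> nat) \<Rightarrow> nat \<Rightarrow> nat" where
  "digit_prefix b w 0 = 0"
| "digit_prefix b w (Suc n) = b * digit_prefix b w n + w n"

definition digit_shift :: "nat \<Rightarrow> (nat \<Rightarrow> nat) \<Rightarrow> nat \<Rightarrow> nat" where
  "digit_shift n w = (\<lambda>i. w (i + n))"

text \<open>Multiplying by \<open>b ^ n\<close> turns distances to b-adic numbers of level n into
  distances to integers. Stating them on reals lets x - y be handled without tracking
  carries.\<close>

definition far :: "real \<Rightarrow> real \<Rightarrow> bool" where
  "far c t \<longleftrightarrow> (\<forall>m::int. c \<le> \<bar>t - of_int m\<bar>)"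

context
  fixes b :: nat
  assumes b2: "b \<ge> 2"
begin

lemma digit_sum_sums_bound:
  "(\<lambda>i. (real b - 1) / real b ^ Suc i) sums 1"
proof -
  have "(\<lambda>i. (1 / real b) ^ i) sums (1 / (1 - 1 / real b))"
    using b2 by (intro geometric_sums) auto
  from sums_mult[OF this, of "(real b - 1) / real b"] show ?thesis
    using b2 by (simp add: power_divide field_simps)
qed

lemma digit_sum_summable:
  assumes "\<And>i. w i < b"
  shows "summable (\<lambda>i. real (w i) / real b ^ Suc i)"
proof (rule summable_comparison_test')
  show "summable (\<lambda>i. (real b - 1) / real b ^ Suc i)"
    using digit_sum_sums_bound by (rule sums_summable)
  show "norm (real (w n) / real b ^ Suc n) \<le> (real b - 1) / real b ^ Suc n" if "n \<ge> 0" for n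
    using assms[of n] b2 by (auto intro!: divide_right_mono)
qed

lemma digit_sum_nonneg: "0 \<le> digit_sum b w" if "\<And>i. w i < b"
  unfolding digit_sum_def using digit_sum_summable[OF that] by (rule suminf_nonneg) simp

lemma digit_sum_le_1:
  assumes "\<And>i. w i < b"
  shows "digit_sum b w \<le> 1"
proof -
  have "digit_sum b w \<le> (\<Sum>i. (real b - 1) / real b ^ Suc i)"
    unfolding digit_sum_def
  proof (rule suminf_le[OF _ digit_sum_summable[OF assms]])
    show "real (w n) / real b ^ Suc n \<le> (real b - 1) / real b ^ Suc n" for n
      using assms[of n] b2 by (intro divide_right_mono) auto
    show "summable (\<lambda>i. (real b - 1) / real b ^ Suc i)"
      using digit_sum_sums_bound by (rule sums_summable)
  qed
  then show ?thesis using digit_sum_sums_bound by (simp add: sums_iff)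
qed

lemma digit_sum_unfold:
  assumes "\<And>i. w i < b"
  shows "b * digit_sum b w = w 0 + digit_sum b (digit_shift 1 w)"
proof -
  have s: "summable (\<lambda>i. real (w i) / real b ^ Suc i)"
    by (rule digit_sum_summable[OF assms])
  have "b * digit_sum b w = (\<Sum>i. b * (real (w i) / real b ^ Suc i))"
    unfolding digit_sum_def using s by (rule suminf_mult[symmetric])
  also have "\<dots> = (\<Sum>i. real (w i) / real b ^ i)"
    using b2 by (intro suminf_cong) auto
  also have "\<dots> = (\<Sum>i. real (w (Suc i)) / real b ^ Suc i) + w 0"
  proof -
    have "summable (\<lambda>i. b * (real (w i) / real b ^ Suc i))"
      using s by (rule summable_mult)
    then have "summable (\<lambda>i. real (w i) / real b ^ i)"
      by (rule summable_cong[THEN iffD1, rotated]) (use b2 in auto)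
    from suminf_split_head[OF this] show ?thesis by simp
  qed
  finally show ?thesis unfolding digit_sum_def digit_shift_def by simp
qed

lemma digit_shift_less: "(\<And>i. w i < b) \<Longrightarrow> digit_shift n w i < b"
  by (simp add: digit_shift_def)

lemma digit_sum_prefix:
  assumes "\<And>i. w i < b"
  shows "real b ^ n * digit_sum b w = digit_prefix b w n + digit_sum b (digit_shift n w)"
proof (induction n)
  case 0 show ?case by (simp add: digit_shift_def)
next
  case (Suc n)
  have "real b ^ Suc n * digit_sum b w = b * (digit_prefix b w n + digit_sum b (digit_shift n w))"
    using Suc by simp
  also have "\<dots> = b * digit_prefix b w n + (w n + digit_sum b (digit_shift (Suc n) w))"
    using digit_sum_unfold[of "digit_shift n w"] assms
    by (simp add: distrib_left digit_shift_def)
  finally show ?case by simp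
qed

lemma digit_prefix_cong: "(\<And>i. i < n \<Longrightarrow> w i = w' i) \<Longrightarrow> digit_prefix b w n = digit_prefix b w' n"
  by (induction n) auto

lemma digit_prefix_inj:
  assumes "\<And>i. w i < b" "\<And>i. w' i < b" "digit_prefix b w n = digit_prefix b w' n" "i < n"
  shows "w i = w' i"
  using assms(3,4)
proof (induction n)
  case (Suc n)
  have "(b * digit_prefix b w n + w n) mod b = (b * digit_prefix b w' n + w' n) mod b"
    "(b * digit_prefix b w n + w n) div b = (b * digit_prefix b w' n + w' n) div b"
    using Suc.prems by simp_all
  then show ?case using assms(1)[of n] assms(2)[of n] b2 Suc
    by (auto simp: less_Suc_eq)
qed simp

lemma digit_sum_agree:
  assumes "\<And>i. w i < b" "\<And>i. w' i < b" "\<And>i. i < n \<Longrightarrow> w i = w' i"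
  shows "\<bar>digit_sum b w - digit_sum b w'\<bar> \<le> 1 / real b ^ n"
proof -
  have "real b ^ n * (digit_sum b w - digit_sum b w') =
      digit_sum b (digit_shift n w) - digit_sum b (digit_shift n w')"
    using digit_sum_prefix[of w n] digit_sum_prefix[of w' n] digit_prefix_cong[OF assms(3), of n] assms
    by (simp add: right_diff_distrib)
  moreover have "\<bar>digit_sum b (digit_shift n w) - digit_sum b (digit_shift n w')\<bar> \<le> 1"
    using digit_sum_nonneg[of "digit_shift n w"] digit_sum_le_1[of "digit_shift n w"]
      digit_sum_nonneg[of "digit_shift n w'"] digit_sum_le_1[of "digit_shift n w'"] assms
    by (simp add: digit_shift_def)
  ultimately have "\<bar>real b ^ n * (digit_sum b w - digit_sum b w')\<bar> \<le> 1" by simp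
  then show ?thesis using b2 by (simp add: abs_mult pos_le_divide_eq mult.commute)
qed

lemma badic_distance_shift:
  assumes "\<And>i. w i < b" "\<And>i. w' i < b"
  obtains k' :: int where "real b ^ n * (digit_sum b w - digit_sum b w' - of_int k / real b ^ n) =
    digit_sum b (digit_shift n w) - digit_sum b (digit_shift n w') - of_int k'"
proof
  show "real b ^ n * (digit_sum b w - digit_sum b w' - of_int k / real b ^ n) =
    digit_sum b (digit_shift n w) - digit_sum b (digit_shift n w')
      - of_int (k - int (digit_prefix b w n) + int (digit_prefix b w' n))"
    using digit_sum_prefix[of w n] digit_sum_prefix[of w' n] assms b2
    by (simp add: right_diff_distrib)
qed

text \<open>A b-adic number of level n \<le> p is also one of level p, so a single position p at
  which the shifted difference stays away from the integers bounds the distance at every level up to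
  p.\<close>

lemma far_badic_distance:
  assumes "\<And>i. w i < b" "\<And>i. w' i < b"
    and "far c (digit_sum b (digit_shift p w) - digit_sum b (digit_shift p w'))" and "n \<le> p"
  shows "c / real b ^ p \<le> \<bar>digit_sum b w - digit_sum b w' - of_int k / real b ^ n\<bar>"
proof -
  have e: "of_int k / real b ^ n = of_int (k * int b ^ (p - n)) / real b ^ p"
    using b2 \<open>n \<le> p\<close> by (simp add: field_simps flip: power_add)
  obtain k' :: int where k': "real b ^ p * (digit_sum b w - digit_sum b w' - of_int (k * int b ^ (p - n)) / real b ^ p) =
    digit_sum b (digit_shift p w) - digit_sum b (digit_shift p w') - of_int k'"
    by (rule badic_distance_shift[OF assms(1,2)])
  have "c \<le> \<bar>real b ^ p * (digit_sum b w - digit_sum b w' - of_int k / real b ^ n)\<bar>"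
    unfolding e k' using assms(3) by (auto simp: far_def)
  then show ?thesis using b2 by (simp add: abs_mult pos_divide_le_eq mult.commute)
qed

lemma digits_floor_mod:
  fixes t :: real
  shows "\<lfloor>real b ^ Suc n * t\<rfloor> = int b * \<lfloor>real b ^ n * t\<rfloor> + \<lfloor>real b ^ Suc n * t\<rfloor> mod int b"
proof -
  have "\<lfloor>real b ^ n * t\<rfloor> = \<lfloor>real b ^ Suc n * t / real b\<rfloor>" using b2 by simp
  also have "\<dots> = \<lfloor>real b ^ Suc n * t\<rfloor> div int b"
    using floor_divide_real_eq_div[of "int b" "real b ^ Suc n * t"] by simp
  finally show ?thesis by simp
qed

text \<open>The words are the base \<open>b\<close> digits of 2 and 5; one of them stays away from \<open>\<theta>\<close> modulo 1.\<close>

lemma breaking_word: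
  assumes "0 \<le> \<theta>" "\<theta> \<le> 1"
  obtains e where "\<And>i. e i < b"
    "\<And>w. (\<And>i. w i < b) \<Longrightarrow> (\<And>i. i < 3 \<Longrightarrow> w i = e i) \<Longrightarrow>
      far (1 / real b ^ 3) (digit_sum b w) \<and> far (1 / real b ^ 3) (digit_sum b w - \<theta>)"
proof -
  \<comment> \<open>In units of \<open>1 / b ^ 3\<close> the prefix W confines the number to
    [W, W + 1]. The intervals [2, 3] and [5, 6] lie on either side of 4, so one of them has distance
    at least 1 from the scaled \<theta>; since \<open>b ^ 3\<close> \<ge> 8, the chosen one keeps
    that distance also from its translates and from the multiples of \<open>b ^ 3\<close>.\<close>
  define W where "W = (if real b ^ 3 * \<theta> \<ge> 4 then 2 else 5 :: nat)"
  define e where "e = (\<lambda>i::nat. if i = 0 then W div b div b else if i = 1 then W div b mod b else W mod b)"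
  have b8: "b ^ 3 \<ge> 8" using power_mono[OF b2, of 3] by simp
  have b8': "real b ^ 3 \<ge> 8" using b8 by (metis of_nat_le_iff of_nat_numeral of_nat_power)
  have W5: "W \<le> 5" by (auto simp: W_def)
  have "W div b div b < b"
  proof -
    have "W < b * b * b" using W5 b8 by (simp add: power3_eq_cube)
    then show ?thesis by (simp add: less_mult_imp_div_less mult.assoc)
  qed
  then have e_less: "e i < b" for i using b2 by (auto simp: e_def)
  have "far (1 / real b ^ 3) (digit_sum b w) \<and> far (1 / real b ^ 3) (digit_sum b w - \<theta>)"
    if w: "\<And>i. w i < b" "\<And>i. i < 3 \<Longrightarrow> w i = e i" for w
  proof -
    have "digit_prefix b w 3 = b * (b * e 0 + e 1) + e 2"
      using w(2) by (simp add: eval_nat_numeral)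
    also have "b * e 0 + e 1 = W div b" by (simp add: e_def)
    also have "b * (W div b) + e 2 = W" by (simp add: e_def)
    finally have "real b ^ 3 * digit_sum b w = W + digit_sum b (digit_shift 3 w)"
      using digit_sum_prefix[of w 3] w(1) by simp
    moreover have "0 \<le> digit_sum b (digit_shift 3 w)" "digit_sum b (digit_shift 3 w) \<le> 1"
      using digit_sum_nonneg digit_sum_le_1 digit_shift_less w(1) by auto
    ultimately have X: "W \<le> real b ^ 3 * digit_sum b w" "real b ^ 3 * digit_sum b w \<le> W + 1" by auto
    have sep: "1 \<le> \<bar>real b ^ 3 * digit_sum b w - Y - real b ^ 3 * of_int m\<bar>"
      if Y: "0 \<le> Y" "Y \<le> real b ^ 3" "Y = 0 \<or> Y = real b ^ 3 * \<theta>" for Y and m :: int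
    proof -
      consider "m = 0" | "m \<ge> 1" | "m \<le> -1" by linarith
      then show ?thesis
      proof cases
        case 1 then show ?thesis using X Y by (auto simp: W_def split: if_splits)
      next
        case 2
        then have "real b ^ 3 * 1 \<le> real b ^ 3 * of_int m" by (intro mult_left_mono) auto
        then show ?thesis using X Y b8' by (auto simp: W_def split: if_splits)
      next
        case 3
        then have "real b ^ 3 * of_int m \<le> real b ^ 3 * (-1)" by (intro mult_left_mono) (auto simp: of_int_le_iff[of m "-1", simplified])
        then show ?thesis using X Y b8' by (auto simp: W_def split: if_splits)
      qed
    qed
    have "1 / real b ^ 3 \<le> \<bar>digit_sum b w - \<theta>' - of_int m\<bar>" if "\<theta>' = 0 \<or> \<theta>' = \<theta>" for \<theta>' and m :: int
    proof -
      have "1 \<le> \<bar>real b ^ 3 * digit_sum b w - real b ^ 3 * \<theta>' - real b ^ 3 * of_int m\<bar>"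
        by (rule sep) (use that assms in \<open>auto simp: mult_left_le\<close>)
      also have "\<dots> = real b ^ 3 * \<bar>digit_sum b w - \<theta>' - of_int m\<bar>"
        by (simp add: abs_mult flip: right_diff_distrib)
      finally show ?thesis using b2 by (simp add: pos_divide_le_eq mult.commute)
    qed
    from this[of 0] this[of \<theta>] show ?thesis by (auto simp: far_def)
  qed
  with e_less that show thesis by blast
qed

end

section \<open>Hausdorff measure and sets of well approximable numbers\<close>

lemma diameter_power_empty [simp]: "diameter_power s {} = 0"
  by (simp add: diameter_power_def)

lemma hausdorff_premeasure_le_cover:
  assumes "A \<subseteq> (\<Union>i. U i)" "\<And>i. bounded (U i)" "\<And>i. diameter (U i) \<le> \<delta>"
  shows "hausdorff_premeasure s \<delta> A \<le> (\<Sum>i::nat. diameter_power s (U i))"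
  unfolding hausdorff_premeasure_def using assms by (intro INF_lower) auto

lemma hausdorff_premeasure_mono:
  "A \<subseteq> B \<Longrightarrow> hausdorff_premeasure s \<delta> A \<le> hausdorff_premeasure s \<delta> B"
  unfolding hausdorff_premeasure_def by (intro INF_superset_mono) auto

lemma hausdorff_measure_mono:
  "A \<subseteq> B \<Longrightarrow> hausdorff_measure s A \<le> hausdorff_measure s B"
  unfolding hausdorff_measure_def by (intro SUP_mono) (auto intro: hausdorff_premeasure_mono)

lemma hausdorff_premeasure_bounded_le:
  assumes "0 \<le> \<delta>" "bounded U" "diameter U \<le> \<delta>"
  shows "hausdorff_premeasure s \<delta> U \<le> diameter_power s U"
proof -
  have "hausdorff_premeasure s \<delta> U \<le> (\<Sum>i::nat. diameter_power s (if i = 0 then U else {}))"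
    by (rule hausdorff_premeasure_le_cover) (use assms in auto)
  also have "\<dots> = (\<Sum>i\<in>{0::nat}. diameter_power s (if i = 0 then U else {}))"
    by (rule suminf_finite) auto
  finally show ?thesis by simp
qed

lemma hausdorff_premeasure_UN_le:
  fixes A :: "nat \<Rightarrow> 'a::metric_space set"
  shows "hausdorff_premeasure s \<delta> (\<Union>i. A i) \<le> (\<Sum>i. hausdorff_premeasure s \<delta> (A i))"
proof (rule ennreal_le_epsilon)
  fix e :: real
  assume fin: "(\<Sum>i. hausdorff_premeasure s \<delta> (A i)) < top" and "0 < e"
  have "\<exists>U::nat \<Rightarrow> 'a set. (A i \<subseteq> (\<Union>j. U j) \<and> (\<forall>j. bounded (U j) \<and> diameter (U j) \<le> \<delta>)) \<and>
      (\<Sum>j. diameter_power s (U j)) \<le> hausdorff_premeasure s \<delta> (A i) + ennreal (e * (1/2) ^ Suc i)" for i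
  proof -
    have "sum (\<lambda>i. hausdorff_premeasure s \<delta> (A i)) {i} \<le> (\<Sum>i. hausdorff_premeasure s \<delta> (A i))"
      by (intro sum_le_suminf) auto
    then have "hausdorff_premeasure s \<delta> (A i) < top" using fin by simp
    then have "hausdorff_premeasure s \<delta> (A i) < hausdorff_premeasure s \<delta> (A i) + ennreal (e * (1/2) ^ Suc i)"
      using \<open>0 < e\<close> by (simp add: ennreal_add_left_cancel_less less_top)
    then obtain U :: "nat \<Rightarrow> 'a set" where
      U: "U \<in> {U. A i \<subseteq> (\<Union>j. U j) \<and> (\<forall>j. bounded (U j) \<and> diameter (U j) \<le> \<delta>)}"
      and le: "(\<Sum>j. diameter_power s (U j)) < hausdorff_premeasure s \<delta> (A i) + ennreal (e * (1/2) ^ Suc i)"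
      by (subst (asm) hausdorff_premeasure_def[of s \<delta> "A i"]) (auto simp only: INF_less_iff)
    show ?thesis using U less_imp_le[OF le] by (intro exI[of _ U]) simp
  qed
  then obtain U :: "nat \<Rightarrow> nat \<Rightarrow> 'a set" where
    U: "\<And>i. A i \<subseteq> (\<Union>j. U i j)" "\<And>i j. bounded (U i j)" "\<And>i j. diameter (U i j) \<le> \<delta>"
      "\<And>i. (\<Sum>j. diameter_power s (U i j)) \<le> hausdorff_premeasure s \<delta> (A i) + ennreal (e * (1/2) ^ Suc i)"
    by metis
  define V where "V = case_prod U \<circ> prod_decode"
  have "(\<Union>i. A i) \<subseteq> (\<Union>n. V n)"
  proof
    fix x assume "x \<in> (\<Union>i. A i)"
    then obtain i j where "x \<in> U i j" using U(1) by blast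
    then have "x \<in> V (prod_encode (i, j))" by (simp add: V_def)
    then show "x \<in> (\<Union>n. V n)" by blast
  qed
  then have "hausdorff_premeasure s \<delta> (\<Union>i. A i) \<le> (\<Sum>n. diameter_power s (V n))"
    by (rule hausdorff_premeasure_le_cover) (auto simp: V_def U split: prod.splits)
  also have "\<dots> = (\<Sum>n. (\<lambda>p. diameter_power s (case_prod U p)) (prod_decode n))"
    by (simp add: V_def)
  also have "\<dots> = (\<Sum>i. \<Sum>j. diameter_power s (U i j))"
    by (rule suminf_ennreal_2dimen) simp
  also have "\<dots> \<le> (\<Sum>i. hausdorff_premeasure s \<delta> (A i) + ennreal (e * (1/2) ^ Suc i))"
    by (intro suminf_le U) auto
  also have "\<dots> = (\<Sum>i. hausdorff_premeasure s \<delta> (A i)) + (\<Sum>i. ennreal (e * (1/2) ^ Suc i))"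
    by (rule suminf_add[symmetric]) auto
  also have "(\<Sum>i. ennreal (e * (1/2) ^ Suc i)) = ennreal e"
    using \<open>0 < e\<close> sums_mult[OF power_half_series, of e]
    by (intro suminf_ennreal_eq) auto
  finally show "hausdorff_premeasure s \<delta> (\<Union>i. A i) \<le> (\<Sum>i. hausdorff_premeasure s \<delta> (A i)) + ennreal e" .
qed

lemma hausdorff_premeasure_finite_UN_le:
  fixes A :: "'b \<Rightarrow> 'a::metric_space set"
  assumes "finite I" "0 \<le> \<delta>"
  shows "hausdorff_premeasure s \<delta> (\<Union>i\<in>I. A i) \<le> (\<Sum>i\<in>I. hausdorff_premeasure s \<delta> (A i))"
proof -
  have empty: "hausdorff_premeasure s \<delta> ({} :: 'a set) = 0"
    using hausdorff_premeasure_bounded_le[of \<delta> "{}" s] \<open>0 \<le> \<delta>\<close> by simp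
  obtain f :: "nat \<Rightarrow> 'b" where f: "bij_betw f {..<card I} I"
    using ex_bij_betw_nat_finite[OF \<open>finite I\<close>] by (auto simp: atLeast0LessThan)
  define B where "B = (\<lambda>i. if i < card I then A (f i) else {})"
  have "(\<Union>i\<in>I. A i) \<subseteq> (\<Union>i. B i)"
  proof
    fix x assume "x \<in> (\<Union>i\<in>I. A i)"
    then obtain i where i: "i \<in> I" "x \<in> A i" by blast
    then obtain j where "j < card I" "i = f j" using bij_betw_imp_surj_on[OF f] by blast
    then have "x \<in> B j" using i by (simp add: B_def)
    then show "x \<in> (\<Union>i. B i)" by blast
  qed
  then have "hausdorff_premeasure s \<delta> (\<Union>i\<in>I. A i) \<le> (\<Sum>i. hausdorff_premeasure s \<delta> (B i))"
    by (rule order_trans[OF hausdorff_premeasure_mono hausdorff_premeasure_UN_le])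
  also have "\<dots> = (\<Sum>i<card I. hausdorff_premeasure s \<delta> (B i))"
    by (rule suminf_finite) (auto simp: B_def empty)
  also have "\<dots> = (\<Sum>i<card I. hausdorff_premeasure s \<delta> (A (f i)))"
    by (simp add: B_def)
  also have "\<dots> = (\<Sum>i\<in>I. hausdorff_premeasure s \<delta> (A i))"
    using sum.reindex_bij_betw[OF f] .
  finally show ?thesis .
qed

lemma hausdorff_measure_UN_null:
  fixes A :: "nat \<Rightarrow> 'a::metric_space set"
  assumes "\<And>i. hausdorff_measure s (A i) = 0"
  shows "hausdorff_measure s (\<Union>i. A i) = 0"
proof -
  have "hausdorff_premeasure s \<delta> (\<Union>i. A i) = 0" if "\<delta> > 0" for \<delta>
  proof -
    have "hausdorff_premeasure s \<delta> (A i) = 0" for i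
    proof -
      have "hausdorff_premeasure s \<delta> (A i) \<le> hausdorff_measure s (A i)"
        unfolding hausdorff_measure_def using that by (intro SUP_upper) auto
      then show ?thesis by (simp add: assms)
    qed
    then show ?thesis using hausdorff_premeasure_UN_le[of s \<delta> A] by simp
  qed
  then show ?thesis unfolding hausdorff_measure_def by (auto intro!: SUP_eq_const simp: bot_ennreal)
qed

text \<open>With exponent 0 every nonempty covering set costs 1. This excludes the exponent 0 from
  the infimum defining the dimension, so the lower bound in \<open>hausdorff_dim_eqI\<close> only
  concerns s > 0.\<close>

lemma hausdorff_measure_0_pos:
  assumes "A \<noteq> {}"
  shows "hausdorff_measure 0 A \<noteq> 0"
proof -
  have "1 \<le> hausdorff_premeasure 0 1 A"
    unfolding hausdorff_premeasure_def
  proof (rule INF_greatest)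
    fix U :: "nat \<Rightarrow> 'a set"
    assume U: "U \<in> {U. A \<subseteq> (\<Union>i. U i) \<and> (\<forall>i. bounded (U i) \<and> diameter (U i) \<le> 1)}"
    then obtain i where "U i \<noteq> {}" using assms by fastforce
    then have "1 = sum (\<lambda>i. diameter_power 0 (U i)) {i}" by (simp add: diameter_power_def)
    also have "\<dots> \<le> (\<Sum>i. diameter_power 0 (U i))" by (intro sum_le_suminf) auto
    finally show "1 \<le> (\<Sum>i. diameter_power 0 (U i))" .
  qed
  also have "\<dots> \<le> hausdorff_measure 0 A"
    unfolding hausdorff_measure_def by (intro SUP_upper) auto
  finally show ?thesis by auto
qed

lemma hausdorff_dim_eqI:
  assumes "A \<noteq> {}" "0 \<le> \<mu>"
    and upper: "\<And>s. s > \<mu> \<Longrightarrow> hausdorff_measure s A = 0"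
    and lower: "\<And>s. 0 < s \<Longrightarrow> s < \<mu> \<Longrightarrow> hausdorff_measure s A \<noteq> 0"
  shows "hausdorff_dim A = ereal \<mu>"
proof -
  let ?S = "{ereal s | s. s \<ge> 0 \<and> hausdorff_measure s A = 0}"
  have "Inf ?S = ereal \<mu>"
  proof (rule antisym)
    show "Inf ?S \<le> ereal \<mu>"
    proof (rule ereal_le_epsilon2)
      fix e :: real assume "0 < e"
      then have "ereal (\<mu> + e) \<in> ?S" using upper[of "\<mu> + e"] \<open>0 \<le> \<mu>\<close> by auto
      then show "Inf ?S \<le> ereal \<mu> + ereal e" by (simp add: Inf_lower)
    qed
    show "ereal \<mu> \<le> Inf ?S"
    proof (rule Inf_greatest)
      fix z assume "z \<in> ?S"
      then obtain s where s: "z = ereal s" "s \<ge> 0" "hausdorff_measure s A = 0" by auto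
      then have "s \<noteq> 0" using hausdorff_measure_0_pos[OF assms(1)] by metis
      then show "ereal \<mu> \<le> z" using s lower[of s] by force
    qed
  qed
  then show ?thesis using assms(1) by (simp add: hausdorff_dim_def)
qed

section \<open>b-adic approximation rates and the covering bound for the dimension\<close>

definition well_approx :: "nat \<Rightarrow> real \<Rightarrow> real \<Rightarrow> bool" where
  "well_approx b \<tau> t \<longleftrightarrow>
     (\<exists>\<^sub>\<infinity>n. \<exists>k::int. \<bar>t - of_int k / real b ^ n\<bar> \<le> real b powr (- \<tau> * real n))"

text \<open>The constant c absorbs finitely many levels, so the bound can be asked at every n. For b
  \<ge> 2 it excludes b-adic t.\<close>

definition badly_approx :: "nat \<Rightarrow> real \<Rightarrow> real \<Rightarrow> bool" where
  "badly_approx b \<tau> t \<longleftrightarrow>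
     (\<exists>c>0. \<forall>n. \<forall>k::int. c * real b powr (- \<tau> * real n) \<le> \<bar>t - of_int k / real b ^ n\<bar>)"

context
  fixes b :: nat
  assumes b2: "b \<ge> 2"
begin

text \<open>Borel-Cantelli covering: level n contributes about b^n balls of radius b^(-\<tau> n),
  and the s-th powers of their diameters sum to a multiple of q^n with q < 1 because s \<tau> > 1.
  The window around z keeps the number of balls per level finite.\<close>

lemma hausdorff_measure_well_approx_bounded:
  assumes "s > 0" "\<tau> > 0" "s * \<tau> > 1"
  shows "hausdorff_measure s {x. \<bar>x - z\<bar> \<le> real M \<and> well_approx b \<tau> (x - z)} = 0"
    (is "hausdorff_measure s ?A = 0")
proof -
  define q where "q = real b powr (1 - s * \<tau>)"
  have q: "0 < q" "q < 1" using b2 assms by (auto simp: q_def powr_less_one)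
  define r where "r = (\<lambda>n. real b powr (- \<tau> * real n))"
  have r_le1: "r n \<le> 1" for n
  proof -
    have "r n \<le> real b powr 0" unfolding r_def using assms b2 by (intro powr_mono) auto
    then show ?thesis using b2 by simp
  qed
  have r_pos: "r n > 0" for n using b2 by (simp add: r_def)
  have r_tendsto: "r \<longlonglongrightarrow> 0"
  proof -
    have "r = (\<lambda>n. (real b powr (-\<tau>)) ^ n)"
      using b2 by (auto simp: r_def powr_power mult.commute)
    moreover have "real b powr (-\<tau>) < 1" using b2 assms by (simp add: powr_less_one)
    ultimately show ?thesis by (simp add: LIMSEQ_power_zero)
  qed
  \<comment> \<open>A centre within \<open>r n\<close> \<le> 1 of a point of the window has distance
    at most M + 1 from z.\<close>
  define I where "I = (\<lambda>n. {- int ((M + 1) * b ^ n)..int ((M + 1) * b ^ n)})"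
  define B where "B = (\<lambda>n. \<Union>k\<in>I n. cball (z + of_int k / real b ^ n) (r n))"
  have A_sub: "?A \<subseteq> (\<Union>n. B (n + N))" for N
  proof
    fix x assume x: "x \<in> ?A"
    then obtain n k where n: "n \<ge> N" and k: "\<bar>x - z - of_int k / real b ^ n\<bar> \<le> r n"
      unfolding well_approx_def r_def INFM_nat_le by blast
    have "\<bar>of_int k / real b ^ n\<bar> \<le> M + 1" using k x r_le1[of n] by auto
    then have "\<bar>of_int k\<bar> \<le> (M + 1) * real b ^ n" using b2 by (simp add: field_simps)
    then have "\<bar>real_of_int k\<bar> \<le> real_of_int (int ((M + 1) * b ^ n))" by (simp add: algebra_simps)
    then have "\<bar>k\<bar> \<le> int ((M + 1) * b ^ n)"
      by (simp only: of_int_abs[symmetric] of_int_le_iff)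
    then have "k \<in> I n" unfolding I_def abs_le_iff by auto
    then have "x \<in> B n" using k by (auto simp: B_def dist_real_def algebra_simps intro!: bexI[of _ k])
    then show "x \<in> (\<Union>n. B (n + N))" using n by (auto intro!: exI[of _ "n - N"])
  qed
  \<comment> \<open>There are at most \<open>3 * (M + 1) * b ^ n\<close> centres at level n;
    \<open>2 powr s\<close> comes from the diameter \<open>2 * r n\<close>.\<close>
  define K where "K = 3 * (real M + 1) * 2 powr s"
  have "hausdorff_premeasure s \<delta> ?A = 0" if "\<delta> > 0" for \<delta>
  proof -
    have pre_B: "hausdorff_premeasure s \<delta> (B n) \<le> ennreal (K * q ^ n)" if n: "2 * r n \<le> \<delta>" for n
    proof -
      have ball: "hausdorff_premeasure s \<delta> (cball c (r n)) \<le> ennreal ((2 * r n) powr s)" for c :: real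
      proof -
        have "diameter (cball c (r n)) = 2 * r n" using r_pos[of n] by simp
        then show ?thesis
          using hausdorff_premeasure_bounded_le[of \<delta> "cball c (r n)" s] n r_pos[of n] assms
          by (auto simp: diameter_power_def split: if_splits)
      qed
      have "hausdorff_premeasure s \<delta> (B n) \<le> (\<Sum>k\<in>I n. hausdorff_premeasure s \<delta> (cball (z + of_int k / real b ^ n) (r n)))"
        unfolding B_def using \<open>\<delta> > 0\<close> by (intro hausdorff_premeasure_finite_UN_le) (auto simp: I_def)
      also have "\<dots> \<le> (\<Sum>k\<in>I n. ennreal ((2 * r n) powr s))" by (intro sum_mono ball)
      also have "\<dots> = ennreal (real (card (I n)) * (2 * r n) powr s)"
        by (simp add: ennreal_of_nat_eq_real_of_nat ennreal_mult')
      also have "\<dots> \<le> ennreal (K * q ^ n)"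
      proof (rule ennreal_leI)
        have "real (card (I n)) = 2 * (real M + 1) * real b ^ n + 1"
        proof -
          have "card (I n) = nat (2 * int ((M + 1) * b ^ n) + 1)" by (simp add: I_def algebra_simps)
          also have "\<dots> = 2 * ((M + 1) * b ^ n) + 1" by linarith
          finally show ?thesis by (simp add: algebra_simps)
        qed
        also have "\<dots> \<le> 3 * (real M + 1) * real b ^ n"
          using mult_mono[of 1 "real M + 1" 1 "real b ^ n"] b2 by (simp add: algebra_simps)
        finally have "real (card (I n)) * (2 * r n) powr s \<le> 3 * (real M + 1) * real b ^ n * (2 * r n) powr s"
          by (intro mult_right_mono) auto
        moreover have "(2 * r n) powr s = 2 powr s * real b powr (- s * \<tau> * real n)"
          using r_pos[of n] by (simp add: powr_mult r_def powr_powr mult_ac)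
        moreover have "q ^ n = real b ^ n * real b powr (- s * \<tau> * real n)"
        proof -
          have "q ^ n = real b powr (real n + - s * \<tau> * real n)"
            using b2 by (simp add: q_def powr_power algebra_simps)
          also have "\<dots> = real b powr real n * real b powr (- s * \<tau> * real n)"
            by (rule powr_add)
          also have "real b powr real n = real b ^ n" using b2 by (simp add: powr_realpow)
          finally show ?thesis .
        qed
        ultimately show "real (card (I n)) * (2 * r n) powr s \<le> K * q ^ n"
          unfolding K_def by (simp only: mult_ac)
      qed
      finally show ?thesis .
    qed
    have "\<forall>\<^sub>F n in sequentially. r n < \<delta> / 2"
      using order_tendstoD(2)[OF r_tendsto, of "\<delta> / 2"] \<open>\<delta> > 0\<close> by simp
    then obtain N0 where N0: "\<And>n. n \<ge> N0 \<Longrightarrow> 2 * r n \<le> \<delta>"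
      unfolding eventually_sequentially by (fastforce simp: field_simps)
    have bound: "hausdorff_premeasure s \<delta> ?A \<le> ennreal (K / (1 - q) * q ^ N)" if "N \<ge> N0" for N
    proof -
      have "hausdorff_premeasure s \<delta> ?A \<le> (\<Sum>n. hausdorff_premeasure s \<delta> (B (n + N)))"
        by (rule order_trans[OF hausdorff_premeasure_mono[OF A_sub] hausdorff_premeasure_UN_le])
      also have "\<dots> \<le> (\<Sum>n. ennreal (K * q ^ N * q ^ n))"
      proof (rule suminf_le)
        show "hausdorff_premeasure s \<delta> (B (n + N)) \<le> ennreal (K * q ^ N * q ^ n)" for n
          using pre_B[OF N0, of "n + N"] that by (simp add: power_add mult_ac)
      qed auto
      also have "\<dots> = ennreal (K * q ^ N * (1 / (1 - q)))"
        using q by (intro suminf_ennreal_eq sums_mult geometric_sums) (auto simp: K_def)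
      finally show ?thesis by (simp add: mult_ac)
    qed
    have "(\<lambda>N. ennreal (K / (1 - q) * q ^ N)) \<longlonglongrightarrow> ennreal (K / (1 - q) * 0)"
      using q by (intro tendsto_ennrealI tendsto_mult tendsto_const LIMSEQ_power_zero) auto
    then have "hausdorff_premeasure s \<delta> ?A \<le> 0"
      using bound by (intro LIMSEQ_le_const[of _ 0]) auto
    then show ?thesis by simp
  qed
  then show ?thesis unfolding hausdorff_measure_def by (auto intro!: SUP_eq_const simp: bot_ennreal)
qed

lemma hausdorff_measure_well_approx:
  assumes "s > 0" "\<tau> > 0" "s * \<tau> > 1"
  shows "hausdorff_measure s {x. well_approx b \<tau> (x - z)} = 0"
proof -
  have "{x. well_approx b \<tau> (x - z)} = (\<Union>M. {x. \<bar>x - z\<bar> \<le> real M \<and> well_approx b \<tau> (x - z)})"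
    by (auto intro: real_arch_simple)
  then show ?thesis
    using hausdorff_measure_UN_null[OF hausdorff_measure_well_approx_bounded[OF assms]] by simp
qed

end

section \<open>Pointwise regularity of Levy functions\<close>

lemma sawtooth_abs_le: "\<bar>sawtooth x\<bar> \<le> 1 / 2"
proof -
  have "of_int \<lfloor>x\<rfloor> \<le> x" "x < of_int \<lfloor>x\<rfloor> + 1" by linarith+
  then have "\<bar>x - of_int \<lfloor>x\<rfloor> - 1 / 2\<bar> \<le> 1 / 2" by linarith
  then show ?thesis by (simp add: sawtooth_def)
qed

lemma sawtooth_minus: "sawtooth (- x) = - sawtooth x"
proof (cases "x \<in> \<int>")
  case False
  then have "\<lceil>x\<rceil> = \<lfloor>x\<rfloor> + 1" by (simp add: ceiling_altdef Ints_def) (metis rangeI)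
  then show ?thesis using False by (simp add: sawtooth_def floor_minus)
qed (simp add: sawtooth_def)

lemma sawtooth_eqI:
  assumes "of_int k < x" "x < of_int k + 1"
  shows "sawtooth x = x - of_int k - 1 / 2"
proof -
  have "\<lfloor>x\<rfloor> = k" using assms by (intro floor_unique) auto
  moreover have "x \<notin> \<int>" using assms by (auto elim!: Ints_cases)
  ultimately show ?thesis by (simp add: sawtooth_def)
qed

lemma sawtooth_add_far:
  assumes "\<And>k::int. \<bar>e\<bar> < \<bar>a - of_int k\<bar>"
  shows "sawtooth (a + e) = sawtooth a + e"
proof -
  have "\<bar>e\<bar> < a - of_int \<lfloor>a\<rfloor>" "\<bar>e\<bar> < of_int \<lfloor>a\<rfloor> + 1 - a"
    using assms[of "\<lfloor>a\<rfloor>"] assms[of "\<lfloor>a\<rfloor> + 1"] by linarith+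
  then have "sawtooth (a + e) = a + e - of_int \<lfloor>a\<rfloor> - 1 / 2" "sawtooth a = a - of_int \<lfloor>a\<rfloor> - 1 / 2"
    by (intro sawtooth_eqI; linarith)+
  then show ?thesis by simp
qed

text \<open>The floor gives the right limit also at integers, where it is -1/2; the left limit uses
  the ceiling and is 1/2 there. The value 0 at the integers is invisible to both.\<close>

lemma sawtooth_tendsto_right:
  assumes "c > 0"
  shows "((\<lambda>t. sawtooth (a + c * t)) \<longlongrightarrow> a - of_int \<lfloor>a\<rfloor> - 1 / 2) (at_right 0)"
proof (rule Lim_transform_eventually)
  show "((\<lambda>t. a + c * t - of_int \<lfloor>a\<rfloor> - 1 / 2) \<longlongrightarrow> a - of_int \<lfloor>a\<rfloor> - 1 / 2) (at_right 0)"
    by (auto intro!: tendsto_eq_intros)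
  show "\<forall>\<^sub>F t in at_right 0. a + c * t - of_int \<lfloor>a\<rfloor> - 1 / 2 = sawtooth (a + c * t)"
  proof (rule eventually_at_rightI)
    show "0 < (of_int \<lfloor>a\<rfloor> + 1 - a) / c" using assms by simp
    fix t assume "t \<in> {0<..<(of_int \<lfloor>a\<rfloor> + 1 - a) / c}"
    then have t: "c * t > 0" "c * t < of_int \<lfloor>a\<rfloor> + 1 - a" using assms by (auto simp: field_simps)
    then have "sawtooth (a + c * t) = a + c * t - of_int \<lfloor>a\<rfloor> - 1 / 2"
      by (intro sawtooth_eqI; linarith)
    then show "a + c * t - of_int \<lfloor>a\<rfloor> - 1 / 2 = sawtooth (a + c * t)" by simp
  qed
qed

lemma sawtooth_tendsto_left:
  assumes "c > 0"
  shows "((\<lambda>t. sawtooth (a - c * t)) \<longlongrightarrow> a - of_int \<lceil>a\<rceil> + 1 / 2) (at_right 0)"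
proof -
  have "((\<lambda>t. - sawtooth (- a + c * t)) \<longlongrightarrow> - (- a - of_int \<lfloor>- a\<rfloor> - 1 / 2)) (at_right 0)"
    by (intro tendsto_minus sawtooth_tendsto_right assms)
  then show ?thesis by (simp add: ceiling_def algebra_simps flip: sawtooth_minus)
qed

context
  fixes b :: nat
  assumes b2: "b \<ge> 2"
begin

section \<open>Powers of b and comparison of the two approximation notions\<close>

lemma powr_mono_exponent: "u \<le> v \<Longrightarrow> real b powr u \<le> real b powr v"
  using b2 by (intro powr_mono) auto

lemma summable_powr_neg:
  assumes "\<delta> > 0"
  shows "summable (\<lambda>i. real b powr (- \<delta> * real (Suc i)))"
proof -
  have "summable (\<lambda>i. (real b powr (- \<delta>)) ^ Suc i)"
    unfolding summable_Suc_iff using b2 assms by (intro summable_geometric) (auto simp: powr_less_one)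
  moreover have "(real b powr (- \<delta>)) ^ Suc i = real b powr (- \<delta> * real (Suc i))" for i
    using b2 by (simp add: powr_power mult.commute del: power_Suc)
  ultimately show ?thesis by (simp only:)
qed

lemma powr_neg_tendsto_0:
  assumes "\<delta> > 0"
  shows "(\<lambda>n. real b powr (- \<delta> * real n)) \<longlonglongrightarrow> 0"
  by (rule LIMSEQ_imp_Suc[OF summable_LIMSEQ_zero[OF summable_powr_neg[OF assms]]])

text \<open>A b-adic number of level n < N is also one of level N, so the bound at N serves all
  smaller levels once c is lowered by the factor b^(-\<tau> N).\<close>

lemma badly_approxI:
  assumes "c > 0" "\<tau> \<ge> 0"
    and "\<And>n k. n \<ge> N \<Longrightarrow> c * real b powr (- \<tau> * real n) \<le> \<bar>t - of_int k / real b ^ n\<bar>"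
  shows "badly_approx b \<tau> t"
proof -
  let ?c = "c * real b powr (- \<tau> * real N)"
  have le1: "real b powr (- \<tau> * real n) \<le> 1" for n
    using powr_mono_exponent[of "- \<tau> * real n" 0] assms b2 by simp
  have "?c * real b powr (- \<tau> * real n) \<le> \<bar>t - of_int k / real b ^ n\<bar>" for n and k :: int
  proof (cases "n \<ge> N")
    case True
    have "?c * real b powr (- \<tau> * real n) \<le> c * real b powr (- \<tau> * real n)"
      using le1[of N] \<open>c > 0\<close> by (intro mult_right_mono) (auto simp: mult_left_le)
    also have "\<dots> \<le> \<bar>t - of_int k / real b ^ n\<bar>" using True by (rule assms(3))
    finally show ?thesis .
  next
    case False
    have "?c * real b powr (- \<tau> * real n) \<le> ?c"
      using le1[of n] \<open>c > 0\<close> by (auto simp: mult_left_le)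
    also have "\<dots> \<le> \<bar>t - of_int (k * int b ^ (N - n)) / real b ^ N\<bar>" by (rule assms(3)) simp
    also have "of_int (k * int b ^ (N - n)) / real b ^ N = of_int k / real b ^ n"
      using False b2 by (simp add: field_simps flip: power_add)
    finally show ?thesis .
  qed
  moreover have "?c > 0" using \<open>c > 0\<close> b2 by simp
  ultimately show ?thesis unfolding badly_approx_def by blast
qed

lemma badly_approx_if_not_well_approx:
  assumes "\<tau> \<ge> 0" "\<not> well_approx b \<tau> t"
  shows "badly_approx b \<tau> t"
proof -
  obtain N where "\<forall>n\<ge>N. \<forall>k::int. \<not> \<bar>t - of_int k / real b ^ n\<bar> \<le> real b powr (- \<tau> * real n)"
    using assms(2) unfolding well_approx_def INFM_nat_le by blast
  then show ?thesis
    using assms(1) by (intro badly_approxI[of 1 \<tau> N]) (auto simp: not_le intro: less_imp_le)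
qed

text \<open>Rounding \<open>b ^ n * t\<close> down errs by at most 1. Every point is thus
  approximated with exponent 1, which is what caps the Hoelder exponent at \<alpha>.\<close>

lemma well_approx_le_1:
  assumes "\<tau> \<le> 1"
  shows "well_approx b \<tau> t"
proof -
  have "\<bar>t - of_int \<lfloor>real b ^ n * t\<rfloor> / real b ^ n\<bar> \<le> real b powr (- \<tau> * real n)" for n
  proof -
    have "\<bar>real b ^ n * t - of_int \<lfloor>real b ^ n * t\<rfloor>\<bar> \<le> 1" by linarith
    moreover have "t - of_int \<lfloor>real b ^ n * t\<rfloor> / real b ^ n =
        (real b ^ n * t - of_int \<lfloor>real b ^ n * t\<rfloor>) / real b ^ n"
      using b2 by (simp add: field_simps)
    ultimately have "\<bar>t - of_int \<lfloor>real b ^ n * t\<rfloor> / real b ^ n\<bar> \<le> 1 / real b ^ n"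
      using b2 by (simp add: divide_right_mono)
    also have "\<dots> = real b powr (- real n)"
      using b2 by (simp add: powr_minus_divide powr_realpow)
    also have "\<dots> \<le> real b powr (- \<tau> * real n)"
      using assms by (intro powr_mono_exponent) (simp add: mult_right_le_one_le mult_left_le_one_le mult_right_mono[of \<tau> 1, simplified])
    finally show ?thesis .
  qed
  then show ?thesis unfolding well_approx_def INFM_nat_le by blast
qed

lemma levy_translated_summable:
  assumes "\<alpha> > 0"
  shows "summable (\<lambda>i. sawtooth (f i) / real b powr (\<alpha> * real (Suc i)))"
proof (rule summable_comparison_test')
  show "summable (\<lambda>i. real b powr (- \<alpha> * real (Suc i)))" by (rule summable_powr_neg[OF assms])
  show "norm (sawtooth (f i) / real b powr (\<alpha> * real (Suc i))) \<le> real b powr (- \<alpha> * real (Suc i))"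
    if "i \<ge> 0" for i
    using sawtooth_abs_le[of "f i"] b2
    by (simp add: powr_minus_divide divide_right_mono del: of_nat_Suc)
qed

text \<open>\<rho> is the distance that b-adic numbers of level n are known to keep. An increment
  that can reach a jump has |h| \<ge> \<rho>, so |h|^\<gamma> pays for the jump. The linear part
  contains |h| = |h|^\<gamma> |h|^(1 - \<gamma>), whose last factor is non-decreasing in |h| for
  \<gamma> \<le> 1 and decreasing for \<gamma> > 1; hence \<rho> bounds it from opposite sides in
  the two cases.\<close>

lemma badly_approx_powr_bounds:
  assumes "c > 0" "h \<noteq> 0" "\<tau> \<ge> 1" and n: "0 \<le> (n::real)"
  defines "\<rho> \<equiv> c * real b powr (- \<tau> * n)"
  shows "\<rho> \<le> \<bar>h\<bar> \<Longrightarrow> \<gamma> > 0 \<Longrightarrow>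
      real b powr (- \<alpha> * n) \<le> \<bar>h\<bar> powr \<gamma> * (c powr (- \<gamma>) * real b powr (- (\<alpha> - \<gamma> * \<tau>) * n))"
    and "(\<gamma> \<le> 1 \<and> \<bar>h\<bar> \<le> \<rho>) \<or> (\<gamma> > 1 \<and> \<rho> \<le> \<bar>h\<bar>) \<Longrightarrow>
      \<bar>h\<bar> * real b powr ((1 - \<alpha>) * n) \<le>
        \<bar>h\<bar> powr \<gamma> * (c powr (1 - \<gamma>) * real b powr (- (\<alpha> - \<gamma> * \<tau>) * n))"
proof -
  have \<rho>: "\<rho> > 0" using assms b2 by (simp add: \<rho>_def)
  have \<rho>_powr: "\<rho> powr e = c powr e * real b powr (- \<tau> * n * e)" for e
    using assms b2 by (simp add: \<rho>_def powr_mult powr_powr)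
  show "real b powr (- \<alpha> * n) \<le> \<bar>h\<bar> powr \<gamma> * (c powr (- \<gamma>) * real b powr (- (\<alpha> - \<gamma> * \<tau>) * n))"
    if "\<rho> \<le> \<bar>h\<bar>" "\<gamma> > 0"
  proof -
    have "real b powr (- \<alpha> * n) = (\<rho> powr \<gamma> * \<rho> powr (- \<gamma>)) * real b powr (- \<alpha> * n)"
      using \<rho> by (simp flip: powr_add)
    also have "\<dots> = \<rho> powr \<gamma> * (c powr (- \<gamma>) * (real b powr (- \<tau> * n * - \<gamma>) * real b powr (- \<alpha> * n)))"
      by (simp only: \<rho>_powr[of "- \<gamma>"] mult.assoc)
    also have "real b powr (- \<tau> * n * - \<gamma>) * real b powr (- \<alpha> * n) = real b powr (- (\<alpha> - \<gamma> * \<tau>) * n)"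
      by (simp add: algebra_simps flip: powr_add)
    also have "\<rho> powr \<gamma> * (c powr (- \<gamma>) * \<dots>) \<le> \<bar>h\<bar> powr \<gamma> * (c powr (- \<gamma>) * \<dots>)"
      using that \<rho> by (intro mult_right_mono powr_mono2) auto
    finally show ?thesis .
  qed
  show "\<bar>h\<bar> * real b powr ((1 - \<alpha>) * n) \<le> \<bar>h\<bar> powr \<gamma> * (c powr (1 - \<gamma>) * real b powr (- (\<alpha> - \<gamma> * \<tau>) * n))"
    if "(\<gamma> \<le> 1 \<and> \<bar>h\<bar> \<le> \<rho>) \<or> (\<gamma> > 1 \<and> \<rho> \<le> \<bar>h\<bar>)"
  proof -
    have "\<bar>h\<bar> powr (1 - \<gamma>) \<le> \<rho> powr (1 - \<gamma>)"
      using that \<rho> by (auto intro: powr_mono2 powr_mono2')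
    have "\<bar>h\<bar> = \<bar>h\<bar> powr \<gamma> * \<bar>h\<bar> powr (1 - \<gamma>)"
      using \<open>h \<noteq> 0\<close> by (simp flip: powr_add)
    also have "\<dots> \<le> \<bar>h\<bar> powr \<gamma> * \<rho> powr (1 - \<gamma>)"
      using \<open>\<bar>h\<bar> powr (1 - \<gamma>) \<le> \<rho> powr (1 - \<gamma>)\<close> by (intro mult_left_mono) auto
    finally have "\<bar>h\<bar> * real b powr ((1 - \<alpha>) * n) \<le> \<bar>h\<bar> powr \<gamma> * \<rho> powr (1 - \<gamma>) * real b powr ((1 - \<alpha>) * n)"
      by (intro mult_right_mono) auto
    also have "\<dots> = \<bar>h\<bar> powr \<gamma> * (c powr (1 - \<gamma>) * (real b powr (- \<tau> * n * (1 - \<gamma>)) * real b powr ((1 - \<alpha>) * n)))"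
      by (simp only: \<rho>_powr mult.assoc)
    also have "real b powr (- \<tau> * n * (1 - \<gamma>)) * real b powr ((1 - \<alpha>) * n) =
        real b powr (- \<tau> * n * (1 - \<gamma>) + (1 - \<alpha>) * n)"
      by (rule powr_add[symmetric])
    also have "\<bar>h\<bar> powr \<gamma> * (c powr (1 - \<gamma>) * \<dots>) \<le>
        \<bar>h\<bar> powr \<gamma> * (c powr (1 - \<gamma>) * real b powr (- (\<alpha> - \<gamma> * \<tau>) * n))"
    proof (intro mult_left_mono powr_mono_exponent)
      \<comment> \<open>Here \<tau> \<ge> 1 enters: the two exponents differ by (1 - \<tau>)
        n.\<close>
      have "n * 1 \<le> n * \<tau>" using assms n by (intro mult_left_mono) auto
      then show "- \<tau> * n * (1 - \<gamma>) + (1 - \<alpha>) * n \<le> - (\<alpha> - \<gamma> * \<tau>) * n"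
        by (simp add: algebra_simps)
    qed auto
    finally show ?thesis .
  qed
qed

text \<open>Only terms crossing a discontinuity differ from their linear part; for \<open>\<gamma> > 1\<close> the linear
  parts are collected in the polynomial, for \<open>\<gamma> \<le> 1\<close> they are small enough to be dropped. In both
  cases the error is estimated term by term.\<close>

lemma levy_holder_at:
  assumes "\<alpha> > 0" "\<tau> \<ge> 1" "\<gamma> > 0" "\<gamma> * \<tau> < \<alpha>" "badly_approx b \<tau> (x - z)"
  shows "holder_at (levy_translated b \<alpha> z) \<gamma> x"
proof -
  obtain c where c: "c > 0"
    "\<And>n k. c * real b powr (- \<tau> * real n) \<le> \<bar>x - z - of_int k / real b ^ n\<bar>"
    using assms(5) unfolding badly_approx_def by blast
  define L where "L = levy_translated b \<alpha> z"
  \<comment> \<open>\<open>degree P < \<gamma>\<close> admits a linear term only for \<gamma> > 1;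
    \<sigma> switches it on and off so that both cases share one estimate.\<close>
  define \<sigma> where "\<sigma> = (if \<gamma> > 1 then 1 else 0 :: real)"
  define lin where "lin = (\<lambda>i. \<sigma> * real b powr ((1 - \<alpha>) * real (Suc i)))"
  define P where "P = [:L x, suminf lin:]"
  define K where "K = c powr (- \<gamma>) + c powr (1 - \<gamma>)"
  define e where "e = (\<lambda>i. real b powr (- (\<alpha> - \<gamma> * \<tau>) * real (Suc i)))"
  have K: "K > 0" using c(1) by (simp add: K_def add_pos_pos)
  \<comment> \<open>As \<gamma> \<le> \<gamma> \<tau> < \<alpha>, the case \<gamma> > 1 forces
    \<alpha> > 1, and then the slopes b^((1 - \<alpha>) n) are summable.\<close>
  have "\<gamma> * 1 \<le> \<gamma> * \<tau>" using assms by (intro mult_left_mono) auto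
  then have "\<gamma> > 1 \<Longrightarrow> \<alpha> > 1" using assms(4) by linarith
  then have lin_summable: "summable lin"
    using summable_powr_neg[of "\<alpha> - 1"] by (auto simp: lin_def \<sigma>_def simp del: of_nat_Suc)
  have e_summable: "summable e" unfolding e_def by (rule summable_powr_neg) (use assms in simp)
  have e_pos: "e i > 0" for i using b2 by (simp add: e_def)
  have deg: "real (degree P) < \<gamma>"
  proof (cases "\<gamma> > 1")
    case True
    have "degree P \<le> 1" by (simp add: P_def)
    then show ?thesis using True by linarith
  next
    case False
    then have "lin = (\<lambda>_. 0)" by (simp add: lin_def \<sigma>_def)
    then show ?thesis using assms by (simp add: P_def)
  qed
  have term_le: "\<bar>sawtooth (real b ^ Suc i * (x + h - z)) / real b powr (\<alpha> * real (Suc i))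
      - sawtooth (real b ^ Suc i * (x - z)) / real b powr (\<alpha> * real (Suc i)) - h * lin i\<bar>
      \<le> \<bar>h\<bar> powr \<gamma> * K * e i" (is "\<bar>?D\<bar> \<le> _") if h: "h \<noteq> 0" for h i
  proof -
    define B where "B = real b powr (\<alpha> * real (Suc i))"
    define A where "A = \<bar>h\<bar> * real b powr ((1 - \<alpha>) * real (Suc i))"
    have B: "B > 0" "1 / B = real b powr (- \<alpha> * real (Suc i))"
      using b2 by (simp_all add: B_def powr_minus_divide)
    have bB: "real b ^ Suc i / B = real b powr ((1 - \<alpha>) * real (Suc i))"
    proof -
      have "real b powr ((1 - \<alpha>) * real (Suc i)) = real b powr (real (Suc i) - \<alpha> * real (Suc i))"
        by (simp only: left_diff_distrib mult_1)
      also have "\<dots> = real b ^ Suc i / B" using b2 unfolding powr_diff B_def by (simp only: powr_realpow)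
      finally show ?thesis by simp
    qed
    note bounds = badly_approx_powr_bounds[OF c(1) h \<open>\<tau> \<ge> 1\<close>, of "real (Suc i)"]
    have c1: "\<bar>h\<bar> powr \<gamma> * (c powr (- \<gamma>) * e i) \<ge> 0" "\<bar>h\<bar> powr \<gamma> * (c powr (1 - \<gamma>) * e i) \<ge> 0"
      using e_pos[of i] by simp_all
    have K_split: "\<bar>h\<bar> powr \<gamma> * K * e i =
        \<bar>h\<bar> powr \<gamma> * (c powr (- \<gamma>) * e i) + \<bar>h\<bar> powr \<gamma> * (c powr (1 - \<gamma>) * e i)"
      by (simp add: K_def algebra_simps)
    show ?thesis
    proof (cases "\<bar>h\<bar> < c * real b powr (- \<tau> * real (Suc i))")
      case True
      \<comment> \<open>So short an increment reaches no discontinuity of this level, and the term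
        changes by exactly its slope times h.\<close>
      have "sawtooth (real b ^ Suc i * (x - z) + real b ^ Suc i * h) = sawtooth (real b ^ Suc i * (x - z)) + real b ^ Suc i * h"
      proof (rule sawtooth_add_far)
        fix k :: int
        have "\<bar>h\<bar> < \<bar>x - z - of_int k / real b ^ Suc i\<bar>" using True c(2)[of "Suc i" k] by linarith
        then have "real b ^ Suc i * \<bar>h\<bar> < real b ^ Suc i * \<bar>x - z - of_int k / real b ^ Suc i\<bar>"
          using b2 by (intro mult_strict_left_mono) auto
        also have "\<dots> = \<bar>real b ^ Suc i * (x - z - of_int k / real b ^ Suc i)\<bar>" by (simp add: abs_mult)
        also have "real b ^ Suc i * (x - z - of_int k / real b ^ Suc i) = real b ^ Suc i * (x - z) - of_int k"
          using b2 by (simp add: right_diff_distrib)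
        finally show "\<bar>real b ^ Suc i * h\<bar> < \<bar>real b ^ Suc i * (x - z) - of_int k\<bar>" by (simp add: abs_mult)
      qed
      moreover have "real b ^ Suc i * (x - z) + real b ^ Suc i * h = real b ^ Suc i * (x + h - z)"
        by (simp add: algebra_simps)
      ultimately have "?D = h * (real b ^ Suc i / B) - h * lin i"
        unfolding B_def[symmetric] by (simp add: add_divide_distrib)
      also have "\<dots> = (1 - \<sigma>) * (h * real b powr ((1 - \<alpha>) * real (Suc i)))"
        unfolding bB by (simp add: lin_def algebra_simps)
      finally have "\<bar>?D\<bar> = \<bar>1 - \<sigma>\<bar> * A" by (simp add: abs_mult A_def)
      also have "\<dots> \<le> \<bar>h\<bar> powr \<gamma> * (c powr (1 - \<gamma>) * e i)"
        using bounds(2)[of \<gamma> \<alpha>] True c1 by (auto simp: \<sigma>_def A_def e_def)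
      finally show ?thesis using c1 K_split by linarith
    next
      case False
      have "\<bar>sawtooth (real b ^ Suc i * (x + h - z)) - sawtooth (real b ^ Suc i * (x - z))\<bar> \<le> 1"
        using sawtooth_abs_le[of "real b ^ Suc i * (x + h - z)"] sawtooth_abs_le[of "real b ^ Suc i * (x - z)"]
        by linarith
      then have "\<bar>(sawtooth (real b ^ Suc i * (x + h - z)) - sawtooth (real b ^ Suc i * (x - z))) / B\<bar> \<le> 1 / B"
        using B(1) by (simp add: divide_right_mono)
      also have "1 / B \<le> \<bar>h\<bar> powr \<gamma> * (c powr (- \<gamma>) * e i)"
        using bounds(1)[of \<gamma> \<alpha>] False assms unfolding B(2) e_def by simp
      moreover have "\<bar>h * lin i\<bar> \<le> \<bar>h\<bar> powr \<gamma> * (c powr (1 - \<gamma>) * e i)"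
        using bounds(2)[of \<gamma> \<alpha>] False c1 by (auto simp: \<sigma>_def lin_def e_def abs_mult)
      ultimately show ?thesis unfolding B_def[symmetric] K_split diff_divide_distrib by linarith
    qed
  qed
  have "\<bar>L x' - poly P (x' - x)\<bar> \<le> (K * suminf e) * \<bar>x' - x\<bar> powr \<gamma>" for x'
  proof (cases "x' = x")
    case True then show ?thesis by (simp add: P_def)
  next
    case False
    define h where "h = x' - x"
    have h: "h \<noteq> 0" "x' = x + h" using False by (auto simp: h_def)
    have s: "summable (\<lambda>i. sawtooth (real b ^ Suc i * (v - z)) / real b powr (\<alpha> * real (Suc i)))" for v
      by (rule levy_translated_summable[OF assms(1)])
    have eq: "L (x + h) - L x - h * suminf lin =
      (\<Sum>i. sawtooth (real b ^ Suc i * (x + h - z)) / real b powr (\<alpha> * real (Suc i))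
      - sawtooth (real b ^ Suc i * (x - z)) / real b powr (\<alpha> * real (Suc i)) - h * lin i)"
      unfolding L_def levy_translated_def
      by (simp only: suminf_diff[OF s s] suminf_diff[OF summable_diff[OF s s] summable_mult[OF lin_summable]]
          suminf_mult[OF lin_summable, symmetric])
    have "norm (L (x + h) - L x - h * suminf lin) \<le> (\<Sum>i. \<bar>h\<bar> powr \<gamma> * K * e i)"
      unfolding eq using term_le[OF h(1)]
      by (intro norm_suminf_le summable_mult e_summable) (simp only: real_norm_def)
    also have "\<dots> = \<bar>h\<bar> powr \<gamma> * K * suminf e" by (rule suminf_mult[OF e_summable])
    finally show ?thesis by (simp add: P_def h mult_ac diff_diff_eq)
  qed
  moreover have "K * suminf e > 0" using K suminf_pos[OF e_summable e_pos] by simp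
  ultimately show ?thesis unfolding holder_at_def L_def[symmetric]
    using deg by (intro exI[of _ "K * suminf e"] conjI exI[of _ 1] exI[of _ P]) auto
qed

text \<open>At a b-adic point d of level n both one-sided limits of the series exist by Tannery's
  theorem, and every level drops there by 0 or by its full weight. All drops have the same sign, so
  nothing cancels the one of level n, while Hoelder regularity bounds the total drop by 2 C |d -
  x|^\<gamma>.\<close>

lemma levy_jump:
  assumes "\<alpha> > 0" "\<gamma> > 0" "holder_at (levy_translated b \<alpha> z) \<gamma> x"
  obtains C r where "C > 0" "r > 0"
    "\<And>n k. n \<ge> 1 \<Longrightarrow> \<bar>x - z - of_int k / real b ^ n\<bar> < r \<Longrightarrow>
      real b powr (- \<alpha> * real n) \<le> C * \<bar>x - z - of_int k / real b ^ n\<bar> powr \<gamma>"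
proof -
  define L where "L = levy_translated b \<alpha> z"
  obtain C r P where C: "C > 0" "r > 0"
    "\<And>x'. x' \<in> {x - r..x + r} \<Longrightarrow> \<bar>L x' - poly P (x' - x)\<bar> \<le> C * \<bar>x' - x\<bar> powr \<gamma>"
    using assms(3) unfolding holder_at_def L_def by blast
  have main: "real b powr (- \<alpha> * real n) \<le> 2 * C * \<bar>x - z - of_int k / real b ^ n\<bar> powr \<gamma>"
    if n: "n \<ge> 1" and near: "\<bar>x - z - of_int k / real b ^ n\<bar> < r" for n and k :: int
  proof -
    define d where "d = z + of_int k / real b ^ n"
    define a where "a = (\<lambda>i. real b ^ Suc i * (d - z))"
    define w where "w = (\<lambda>i. real b powr (\<alpha> * real (Suc i)))"
    define R where "R = (\<lambda>i. (a i - of_int \<lfloor>a i\<rfloor> - 1 / 2) / w i)"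
    define Lf where "Lf = (\<lambda>i. (a i - of_int \<lceil>a i\<rceil> + 1 / 2) / w i)"
    have w: "w i > 0" for i using b2 by (simp add: w_def)
    have w_summable: "summable (\<lambda>i. 1 / 2 / w i)"
    proof -
      have "summable (\<lambda>i. 1 / 2 * real b powr (- \<alpha> * real (Suc i)))"
        by (intro summable_mult summable_powr_neg assms)
      then show ?thesis by (simp add: w_def powr_minus_divide del: of_nat_Suc)
    qed
    have term_bound: "norm (sawtooth v / w i) \<le> 1 / 2 / w i" for v i
      using divide_right_mono[OF sawtooth_abs_le[of v], of "w i"] w[of i] by simp
    have right: "((\<lambda>t. L (d + t)) \<longlongrightarrow> suminf R) (at_right 0)" and R_summable: "summable R"
    proof -
      have lim: "((\<lambda>t. sawtooth (a i + real b ^ Suc i * t) / w i) \<longlongrightarrow> R i) (at_right 0)" for i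
        unfolding R_def using b2 w[of i] by (intro tendsto_divide sawtooth_tendsto_right tendsto_const) auto
      have "\<forall>\<^sub>F (i, t) in sequentially \<times>\<^sub>F at_right 0.
          norm (sawtooth (a i + real b ^ Suc i * t) / w i) \<le> 1 / 2 / w i"
        by (intro always_eventually) (simp only: split_paired_All prod.case term_bound simp_thms)
      from tannerys_theorem[OF lim this w_summable trivial_limit_at_right_real]
      have *: "summable (\<lambda>i. norm (R i))"
        "((\<lambda>t. \<Sum>i. sawtooth (a i + real b ^ Suc i * t) / w i) \<longlongrightarrow> suminf R) (at_right 0)"
        by simp_all
      show "summable R" using *(1) by (rule summable_norm_cancel)
      have "L (d + t) = (\<Sum>i. sawtooth (a i + real b ^ Suc i * t) / w i)" for t
        unfolding L_def levy_translated_def a_def w_def by (simp only: algebra_simps)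
      then show "((\<lambda>t. L (d + t)) \<longlongrightarrow> suminf R) (at_right 0)" using *(2) by simp
    qed
    have left: "((\<lambda>t. L (d - t)) \<longlongrightarrow> suminf Lf) (at_right 0)" and Lf_summable: "summable Lf"
    proof -
      have lim: "((\<lambda>t. sawtooth (a i - real b ^ Suc i * t) / w i) \<longlongrightarrow> Lf i) (at_right 0)" for i
        unfolding Lf_def using b2 w[of i] by (intro tendsto_divide sawtooth_tendsto_left tendsto_const) auto
      have "\<forall>\<^sub>F (i, t) in sequentially \<times>\<^sub>F at_right 0.
          norm (sawtooth (a i - real b ^ Suc i * t) / w i) \<le> 1 / 2 / w i"
        by (intro always_eventually) (simp only: split_paired_All prod.case term_bound simp_thms)
      from tannerys_theorem[OF lim this w_summable trivial_limit_at_right_real]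
      have *: "summable (\<lambda>i. norm (Lf i))"
        "((\<lambda>t. \<Sum>i. sawtooth (a i - real b ^ Suc i * t) / w i) \<longlongrightarrow> suminf Lf) (at_right 0)"
        by simp_all
      show "summable Lf" using *(1) by (rule summable_norm_cancel)
      have "L (d - t) = (\<Sum>i. sawtooth (a i - real b ^ Suc i * t) / w i)" for t
        unfolding L_def levy_translated_def a_def w_def by (simp only: algebra_simps)
      then show "((\<lambda>t. L (d - t)) \<longlongrightarrow> suminf Lf) (at_right 0)" using *(2) by simp
    qed
    \<comment> \<open>The Hoelder inequality survives both one-sided limits; e = 1 or -1 selects the
      side. The polynomial has the same value on both sides and cancels from the difference.\<close>
    have limit_le: "\<bar>l - poly P (d - x)\<bar> \<le> C * \<bar>d - x\<bar> powr \<gamma>"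
      if l: "((\<lambda>t. L (d + e * t)) \<longlongrightarrow> l) (at_right 0)" and e: "\<bar>e\<bar> \<le> 1" for e l
    proof (rule tendsto_le)
      show "((\<lambda>t. \<bar>L (d + e * t) - poly P (d + e * t - x)\<bar>) \<longlongrightarrow> \<bar>l - poly P (d - x)\<bar>) (at_right 0)"
        by (intro tendsto_rabs tendsto_diff l tendsto_poly) (auto intro!: tendsto_eq_intros)
      show "((\<lambda>t. C * \<bar>d + e * t - x\<bar> powr \<gamma>) \<longlongrightarrow> C * \<bar>d - x\<bar> powr \<gamma>) (at_right 0)"
        using assms(2) by (intro tendsto_mult tendsto_const tendsto_powr' tendsto_rabs) (auto intro!: tendsto_eq_intros)
      show "\<forall>\<^sub>F t in at_right 0. \<bar>L (d + e * t) - poly P (d + e * t - x)\<bar> \<le> C * \<bar>d + e * t - x\<bar> powr \<gamma>"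
      proof (rule eventually_at_rightI)
        show "0 < r - \<bar>x - d\<bar>" using near by (simp add: d_def diff_diff_eq)
        fix t assume t: "t \<in> {0<..<r - \<bar>x - d\<bar>}"
        have "\<bar>e * t\<bar> \<le> t" using mult_right_mono[OF e, of t] t by (simp add: abs_mult)
        then show "\<bar>L (d + e * t) - poly P (d + e * t - x)\<bar> \<le> C * \<bar>d + e * t - x\<bar> powr \<gamma>"
          using t by (intro C(3)) auto
      qed
    qed simp
    have close: "\<bar>suminf Lf - suminf R\<bar> \<le> 2 * (C * \<bar>d - x\<bar> powr \<gamma>)"
      using limit_le[of 1 "suminf R"] limit_le[of "-1" "suminf Lf"] right left by simp
    have jump: "Lf i - R i = (1 + of_int \<lfloor>a i\<rfloor> - of_int \<lceil>a i\<rceil>) / w i" for i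
      unfolding Lf_def R_def by (simp add: diff_divide_distrib add_divide_distrib)
    have nonneg: "Lf i - R i \<ge> 0" for i
    proof -
      have "real_of_int (\<lceil>a i\<rceil> - \<lfloor>a i\<rfloor>) \<le> 1"
        using ceiling_diff_floor_le_1[of "a i"] by (simp only: of_int_le_1_iff)
      then show ?thesis unfolding jump using w[of i] by (intro divide_nonneg_pos) auto
    qed
    \<comment> \<open>The series starts with level 1 at index 0, so level n has index n - 1; this is
      why n \<ge> 1 is asked.\<close>
    have "a (n - 1) = of_int k" using n b2 by (simp add: a_def d_def flip: power_Suc)
    then have "real b powr (- \<alpha> * real n) = sum (\<lambda>i. Lf i - R i) {n - 1}"
      using n by (simp add: jump w_def powr_minus_divide)
    also have "\<dots> \<le> (\<Sum>i. Lf i - R i)"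
      using Lf_summable R_summable nonneg by (intro sum_le_suminf summable_diff) auto
    also have "\<dots> = suminf Lf - suminf R" by (rule suminf_diff[OF Lf_summable R_summable, symmetric])
    finally show ?thesis using close by (simp add: d_def diff_diff_eq abs_minus_commute)
  qed
  show thesis by (rule that[of "2 * C" r]) (use C main in auto)
qed

text \<open>Inserting the good approximations into the jump bound gives b^(-\<alpha> n) \<le> C
  b^(-\<gamma> \<tau> n) for infinitely many n, which fails if \<gamma> \<tau> exceeds
  \<alpha>.\<close>

lemma holder_at_le_if_well_approx:
  assumes "\<alpha> > 0" "\<gamma> > 0" "\<tau> > 0" "holder_at (levy_translated b \<alpha> z) \<gamma> x" "well_approx b \<tau> (x - z)"
  shows "\<gamma> * \<tau> \<le> \<alpha>"
proof (rule ccontr)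
  assume "\<not> \<gamma> * \<tau> \<le> \<alpha>"
  then have \<delta>: "\<gamma> * \<tau> - \<alpha> > 0" by simp
  obtain C r where C: "C > 0" "r > 0"
    "\<And>n k. n \<ge> 1 \<Longrightarrow> \<bar>x - z - of_int k / real b ^ n\<bar> < r \<Longrightarrow>
      real b powr (- \<alpha> * real n) \<le> C * \<bar>x - z - of_int k / real b ^ n\<bar> powr \<gamma>"
    using levy_jump[OF assms(1,2,4)] by metis
  have "\<forall>\<^sub>F n in sequentially. real b powr (- \<tau> * real n) < r"
    by (rule order_tendstoD(2)[OF powr_neg_tendsto_0[OF \<open>\<tau> > 0\<close>] \<open>r > 0\<close>])
  moreover have "\<forall>\<^sub>F n in sequentially. real b powr (- (\<gamma> * \<tau> - \<alpha>) * real n) < 1 / C"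
    by (rule order_tendstoD(2)[OF powr_neg_tendsto_0[OF \<delta>]]) (use \<open>C > 0\<close> in simp)
  ultimately have "\<forall>\<^sub>F n in sequentially. n \<ge> 1 \<and> real b powr (- \<tau> * real n) < r \<and>
      real b powr (- (\<gamma> * \<tau> - \<alpha>) * real n) < 1 / C"
    using eventually_ge_at_top[of "1::nat"] by eventually_elim auto
  then obtain N where N: "\<And>n. n \<ge> N \<Longrightarrow> n \<ge> 1" "\<And>n. n \<ge> N \<Longrightarrow> real b powr (- \<tau> * real n) < r"
    "\<And>n. n \<ge> N \<Longrightarrow> real b powr (- (\<gamma> * \<tau> - \<alpha>) * real n) < 1 / C"
    unfolding eventually_sequentially by blast
  obtain n k where n: "n \<ge> N" and k: "\<bar>x - z - of_int k / real b ^ n\<bar> \<le> real b powr (- \<tau> * real n)"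
    using assms(5) unfolding well_approx_def INFM_nat_le by blast
  have "real b powr (- \<alpha> * real n) \<le> C * \<bar>x - z - of_int k / real b ^ n\<bar> powr \<gamma>"
    using N(1,2)[OF n] k by (intro C(3)) auto
  also have "\<dots> \<le> C * (real b powr (- \<tau> * real n)) powr \<gamma>"
    using C(1) k assms(2) by (intro mult_left_mono powr_mono2) auto
  also have "(real b powr (- \<tau> * real n)) powr \<gamma> =
      real b powr (- (\<gamma> * \<tau> - \<alpha>) * real n) * real b powr (- \<alpha> * real n)"
    by (simp add: powr_powr algebra_simps flip: powr_add)
  also have "C * \<dots> < C * (1 / C * real b powr (- \<alpha> * real n))"
    using C(1) N(3)[OF n] b2 by (intro mult_strict_left_mono mult_strict_right_mono) auto
  finally show False using C(1) by simp
qed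

lemma holder_exponent_levy_bounds:
  assumes "\<alpha> > 0"
  shows "0 \<le> holder_exponent (levy_translated b \<alpha> z) x"
    and "holder_exponent (levy_translated b \<alpha> z) x \<le> ereal \<alpha>"
proof -
  show "0 \<le> holder_exponent (levy_translated b \<alpha> z) x"
    unfolding holder_exponent_def by (rule Sup_upper) simp
  show "holder_exponent (levy_translated b \<alpha> z) x \<le> ereal \<alpha>"
    unfolding holder_exponent_def
    using holder_at_le_if_well_approx[OF assms _ _ _ well_approx_le_1, of _ 1 z x] assms
    by (intro Sup_least) auto
qed

text \<open>Otherwise x - z would be badly approximable, and \<open>levy_holder_at\<close> would
  yield regularity for some \<gamma> strictly between H and \<alpha> / \<tau>. The covering argument
  for the upper bound rests on this direction.\<close>

lemma well_approx_if_holder_exponent: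
  assumes "\<alpha> > 0" "\<tau> > 0" "H * \<tau> < \<alpha>"
    and H: "holder_exponent (levy_translated b \<alpha> z) x = ereal H"
  shows "well_approx b \<tau> (x - z)"
proof (rule ccontr)
  assume not: "\<not> well_approx b \<tau> (x - z)"
  then have "\<tau> > 1" using well_approx_le_1 by (meson not_le)
  have "H \<ge> 0" using holder_exponent_levy_bounds(1)[OF assms(1)] H by (metis ereal_less_eq(5))
  have "H < \<alpha> / \<tau>" using assms by (simp add: pos_less_divide_eq)
  then obtain \<gamma> where \<gamma>: "H < \<gamma>" "\<gamma> < \<alpha> / \<tau>" using dense by blast
  have "holder_at (levy_translated b \<alpha> z) \<gamma> x"
    using \<gamma> \<open>H \<ge> 0\<close> \<open>\<tau> > 1\<close> assms badly_approx_if_not_well_approx[OF _ not]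
    by (intro levy_holder_at[of \<alpha> \<tau>]) (auto simp: pos_less_divide_eq)
  then have "ereal \<gamma> \<le> holder_exponent (levy_translated b \<alpha> z) x"
    unfolding holder_exponent_def using \<gamma> \<open>H \<ge> 0\<close> by (intro Sup_upper) auto
  then show False using \<gamma> H by simp
qed

text \<open>Here 1 / u is the approximation exponent. Multiplying \<tau> by u instead of dividing
  admits u = 0, where every \<tau> > 0 must approximate well and the last hypothesis is
  vacuous.\<close>

lemma holder_exponent_levy:
  assumes "\<alpha> > 0" "0 \<le> u" "u \<le> 1"
    and well: "\<And>\<tau>. \<tau> > 0 \<Longrightarrow> \<tau> * u < 1 \<Longrightarrow> well_approx b \<tau> (x - z)"
    and badly: "\<And>\<tau>. \<tau> * u > 1 \<Longrightarrow> badly_approx b \<tau> (x - z)"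
  shows "holder_exponent (levy_translated b \<alpha> z) x = ereal (\<alpha> * u)"
proof (rule antisym)
  let ?L = "levy_translated b \<alpha> z"
  have au: "\<alpha> * u \<ge> 0" using assms by simp
  have "\<gamma> \<le> \<alpha> * u" if "\<gamma> > 0" "holder_at ?L \<gamma> x" for \<gamma>
  proof (rule ccontr)
    assume less: "\<not> \<gamma> \<le> \<alpha> * u"
    \<comment> \<open>\<open>1 / \<tau>\<close> is the midpoint of
      \<open>\<gamma> / \<alpha>\<close> and u, so \<tau> separates the two rates; the same choice
      serves the other inequality.\<close>
    define \<tau> where "\<tau> = 2 * \<alpha> / (\<gamma> + \<alpha> * u)"
    have pos: "\<gamma> + \<alpha> * u > 0" using that au by simp
    have "\<tau> > 0" using pos assms by (simp add: \<tau>_def)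
    moreover have "\<tau> * u < 1" using pos less by (simp add: \<tau>_def pos_divide_less_eq)
    ultimately have "\<gamma> * \<tau> \<le> \<alpha>" using holder_at_le_if_well_approx[OF assms(1) that(1) _ that(2)] well by blast
    then have "2 * \<gamma> * \<alpha> \<le> \<alpha> * (\<gamma> + \<alpha> * u)" using pos by (simp add: \<tau>_def pos_divide_le_eq mult_ac)
    then have "\<alpha> * (2 * \<gamma>) \<le> \<alpha> * (\<gamma> + \<alpha> * u)" by (simp add: mult_ac)
    then have "2 * \<gamma> \<le> \<gamma> + \<alpha> * u" using assms(1) by (rule mult_left_le_imp_le)
    then show False using less by simp
  qed
  then show "holder_exponent ?L x \<le> ereal (\<alpha> * u)"
    unfolding holder_exponent_def using au by (intro Sup_least) auto
  show "ereal (\<alpha> * u) \<le> holder_exponent ?L x"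
  proof (rule ccontr)
    assume "\<not> ereal (\<alpha> * u) \<le> holder_exponent ?L x"
    then obtain \<gamma> where "holder_exponent ?L x < ereal \<gamma>" "ereal \<gamma> < ereal (\<alpha> * u)"
      using ereal_dense2 by (meson not_le)
    then have \<gamma>: "holder_exponent ?L x < ereal \<gamma>" "\<gamma> < \<alpha> * u" "\<gamma> > 0"
      using holder_exponent_levy_bounds(1)[OF assms(1), of z x] by (auto dest: order.strict_trans1)
    define \<tau> where "\<tau> = 2 * \<alpha> / (\<gamma> + \<alpha> * u)"
    have pos: "\<gamma> + \<alpha> * u > 0" using \<gamma> au by simp
    have \<tau>u: "\<tau> * u > 1" using pos \<gamma> by (simp add: \<tau>_def pos_less_divide_eq)
    have "\<tau> > 0" using pos assms by (simp add: \<tau>_def)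
    then have "\<tau> * u \<le> \<tau> * 1" using assms by (intro mult_left_mono) auto
    then have "\<tau> \<ge> 1" using \<tau>u by simp
    moreover have "\<gamma> * \<tau> < \<alpha>"
    proof -
      have "\<alpha> * (2 * \<gamma>) < \<alpha> * (\<gamma> + \<alpha> * u)" using \<gamma> assms(1) by (intro mult_strict_left_mono) auto
      then show ?thesis using pos by (simp add: \<tau>_def pos_divide_less_eq mult_ac)
    qed
    ultimately have "holder_at ?L \<gamma> x" using \<gamma> badly[OF \<tau>u] assms by (intro levy_holder_at) auto
    then have "ereal \<gamma> \<le> holder_exponent ?L x"
      unfolding holder_exponent_def using \<gamma> by (intro Sup_upper) auto
    then show False using \<gamma> by simp
  qed
qed

end

section \<open>Sets with prescribed digits\<close>

definition free_count :: "nat set \<Rightarrow> nat \<Rightarrow> nat" where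
  "free_count D n = card ({..<n} - D)"

text \<open>The digits of \<open>t\<close> are written into the positions outside \<open>D\<close>.\<close>

definition spread_digits :: "nat \<Rightarrow> nat set \<Rightarrow> (nat \<Rightarrow> nat) \<Rightarrow> real \<Rightarrow> nat \<Rightarrow> nat" where
  "spread_digits b D d t n =
     (if n \<in> D then d n else nat (\<lfloor>real b ^ Suc (free_count D n) * t\<rfloor> mod int b))"

lemma free_count_0 [simp]: "free_count D 0 = 0"
  by (simp add: free_count_def)

lemma free_count_Suc: "free_count D (Suc n) = (if n \<in> D then free_count D n else Suc (free_count D n))"
proof -
  have "{..<Suc n} - D = (if n \<in> D then {..<n} - D else insert n ({..<n} - D))"
    by (auto simp: less_Suc_eq)
  then show ?thesis by (simp add: free_count_def)
qed

context
  fixes b :: nat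
  assumes b2: "b \<ge> 2"
begin

lemma spread_digits_less: "d n < b \<Longrightarrow> spread_digits b D d t n < b"
proof -
  assume "d n < b"
  have "\<lfloor>real b ^ Suc (free_count D n) * t\<rfloor> mod int b < int b" using b2 by simp
  then have "nat (\<lfloor>real b ^ Suc (free_count D n) * t\<rfloor> mod int b) < b" using b2 by linarith
  then show ?thesis using \<open>d n < b\<close> by (simp add: spread_digits_def)
qed

text \<open>The floor after the next free digit is determined by the previous floor and that digit.
  Hence all t whose words agree below n lie in one interval of length
  \<open>1 / b ^ free_count D n\<close>.\<close>

lemma spread_digits_inj:
  assumes "0 \<le> t" "t < 1" "0 \<le> t'" "t' < 1"
    and "\<And>i. i < n \<Longrightarrow> spread_digits b D d t i = spread_digits b D d t' i"
  shows "\<lfloor>real b ^ free_count D n * t\<rfloor> = \<lfloor>real b ^ free_count D n * t'\<rfloor>"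
  using assms(5)
proof (induction n)
  case 0
  have "\<lfloor>t\<rfloor> = 0" "\<lfloor>t'\<rfloor> = 0" using assms(1-4) by linarith+
  then show ?case by simp
next
  case (Suc n)
  then have IH: "\<lfloor>real b ^ free_count D n * t\<rfloor> = \<lfloor>real b ^ free_count D n * t'\<rfloor>" by simp
  show ?case
  proof (cases "n \<in> D")
    case True then show ?thesis using IH by (simp add: free_count_Suc)
  next
    case False
    have "nat (\<lfloor>real b ^ Suc (free_count D n) * t\<rfloor> mod int b) =
        nat (\<lfloor>real b ^ Suc (free_count D n) * t'\<rfloor> mod int b)"
      using Suc.prems[of n] False by (simp add: spread_digits_def)
    then have "\<lfloor>real b ^ Suc (free_count D n) * t\<rfloor> mod int b =
        \<lfloor>real b ^ Suc (free_count D n) * t'\<rfloor> mod int b"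
      using b2 by (subst (asm) eq_nat_nat_iff) auto
    then show ?thesis
      using digits_floor_mod[OF b2, of "free_count D n" t] digits_floor_mod[OF b2, of "free_count D n" t'] IH False
      by (simp only: free_count_Suc if_False)
  qed
qed

text \<open>If two values differ by at most \<open>1 / b ^ N\<close>, their prefixes, read as
  integers, differ by at most 2, so at most 5 prefixes occur; each confines t to one interval by
  \<open>spread_digits_inj\<close>. The Borel superset J avoids any question about the measurability
  of the set of t.\<close>

lemma spread_digits_level_cover:
  assumes d: "\<And>i. d i < b" and U: "bounded U" "diameter U \<le> 1 / real b ^ N"
  obtains J where "J \<in> sets lborel"
    "{t. 0 \<le> t \<and> t < 1 \<and> digit_sum b (spread_digits b D d t) \<in> U} \<subseteq> J"
    "emeasure lborel J \<le> ennreal (5 / real b ^ free_count D N)"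
proof -
  let ?G = "{t. 0 \<le> t \<and> t < 1 \<and> digit_sum b (spread_digits b D d t) \<in> U}"
  show thesis
  proof (cases "?G = {}")
    case True
    show thesis using that[of "{}"] True by auto
  next
    case False
    then obtain t0 where t0: "t0 \<in> ?G" by blast
    define P where "P = (\<lambda>t. int (digit_prefix b (spread_digits b D d t) N))"
    define \<delta> where "\<delta> = 1 / real b ^ free_count D N"
    have \<delta>: "\<delta> > 0" using b2 by (simp add: \<delta>_def)
    have w_less: "spread_digits b D d t i < b" for t i by (rule spread_digits_less) (rule d)
    define I where "I = {P t0 - 2..P t0 + 2}"
    have P_in: "P t \<in> I" if t: "t \<in> ?G" for t
    proof -
      have "\<bar>digit_sum b (spread_digits b D d t) - digit_sum b (spread_digits b D d t0)\<bar> \<le> 1 / real b ^ N"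
        using diameter_bounded_bound[OF U(1)] t t0 U(2) by (fastforce simp: dist_real_def)
      then have "\<bar>real b ^ N * digit_sum b (spread_digits b D d t) - real b ^ N * digit_sum b (spread_digits b D d t0)\<bar> \<le> 1"
        using b2 by (simp add: pos_le_divide_eq mult.commute abs_mult flip: right_diff_distrib)
      moreover have "real_of_int (P s) \<le> real b ^ N * digit_sum b (spread_digits b D d s)"
        "real b ^ N * digit_sum b (spread_digits b D d s) \<le> real_of_int (P s) + 1" for s
        using digit_sum_prefix[OF b2, where w = "spread_digits b D d s" and n = N, OF w_less]
          digit_sum_nonneg[OF b2, of "digit_shift N (spread_digits b D d s)"]
          digit_sum_le_1[OF b2, of "digit_shift N (spread_digits b D d s)"]
        by (simp_all add: P_def digit_shift_def w_less)
      from this[of t] this[of t0] have "\<bar>real_of_int (P t) - real_of_int (P t0)\<bar> \<le> 2"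
        using calculation by linarith
      then show ?thesis unfolding I_def by simp linarith
    qed
    have "\<exists>q. \<forall>t. 0 \<le> t \<and> t < 1 \<and> P t = k \<longrightarrow> t \<in> {q..q + \<delta>}" for k
    proof (cases "\<exists>t. 0 \<le> t \<and> t < 1 \<and> P t = k")
      case True
      then obtain t1 where t1: "0 \<le> t1" "t1 < 1" "P t1 = k" by blast
      show ?thesis
      proof (intro exI[of _ "of_int \<lfloor>real b ^ free_count D N * t1\<rfloor> * \<delta>"] allI impI)
        fix t assume t: "0 \<le> t \<and> t < 1 \<and> P t = k"
        have "\<lfloor>real b ^ free_count D N * t\<rfloor> = \<lfloor>real b ^ free_count D N * t1\<rfloor>"
          using t t1 digit_prefix_inj[OF b2 w_less w_less]
          by (intro spread_digits_inj) (auto simp: P_def)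
        then have "of_int \<lfloor>real b ^ free_count D N * t1\<rfloor> \<le> real b ^ free_count D N * t"
          "real b ^ free_count D N * t \<le> of_int \<lfloor>real b ^ free_count D N * t1\<rfloor> + 1" by linarith+
        then show "t \<in> {of_int \<lfloor>real b ^ free_count D N * t1\<rfloor> * \<delta>..of_int \<lfloor>real b ^ free_count D N * t1\<rfloor> * \<delta> + \<delta>}"
          using b2 by (simp add: \<delta>_def pos_divide_le_eq pos_le_divide_eq mult.commute flip: add_divide_distrib)
      qed
    qed blast
    then obtain q where q: "\<And>k t. 0 \<le> t \<and> t < 1 \<and> P t = k \<Longrightarrow> t \<in> {q k..q k + \<delta>}" by metis
    define J where "J = (\<Union>k\<in>I. {q k..q k + \<delta>})"
    show thesis
    proof (rule that[of J])
      show "J \<in> sets lborel" by (auto simp: J_def I_def intro!: sets.finite_UN)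
      show "?G \<subseteq> J"
      proof
        fix t assume "t \<in> ?G"
        then show "t \<in> J" using P_in[of t] q[of t "P t"] unfolding J_def by blast
      qed
      have "emeasure lborel J \<le> (\<Sum>k\<in>I. emeasure lborel {q k..q k + \<delta>})"
        unfolding J_def by (rule emeasure_subadditive_finite) (auto simp: I_def)
      also have "\<dots> = (\<Sum>k\<in>I. ennreal \<delta>)" using \<delta> by simp
      also have "\<dots> = ennreal (5 * \<delta>)"
        using \<delta> by (simp add: I_def ennreal_of_nat_eq_real_of_nat ennreal_mult' del: sum_constant) (simp add: ennreal_mult')
      finally show "emeasure lborel J \<le> ennreal (5 / real b ^ free_count D N)" by (simp add: \<delta>_def)
    qed
  qed
qed

text \<open>Choosing N with b^(-N-1) < diam U \<le> b^(-N) turns the level bound into a multiple of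
  (diam U)^s. In the constant, \<open>N0\<close> pays for sets too large for the range of
  \<open>free\<close> and 1 for the rounding of N. The \<epsilon> is for nonempty sets of diameter
  0, which have no such N and whose diameter power is 0.\<close>

lemma spread_digits_cover:
  assumes d: "\<And>i. d i < b" and "s > 0" and free: "\<And>n. n \<ge> N0 \<Longrightarrow> s * real n \<le> real (free_count D n)"
    and U: "bounded U" and "\<epsilon> > 0"
  shows "\<exists>J\<in>sets lborel. {t. 0 \<le> t \<and> t < 1 \<and> digit_sum b (spread_digits b D d t) \<in> U} \<subseteq> J \<and>
    emeasure lborel J \<le> ennreal (5 * real b powr (s * (real N0 + 1))) * diameter_power s U + ennreal \<epsilon>"
proof -
  define C where "C = 5 * real b powr (s * (real N0 + 1))"
  define r where "r = diameter U"
  have r: "r \<ge> 0" using diameter_ge_0[OF U] by (simp add: r_def)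
  have C: "C \<ge> 0" by (simp add: C_def)
  have level: "5 / real b ^ free_count D n \<le> 5 * real b powr (- s * real n)" if "n \<ge> N0" for n
  proof -
    have "1 / real b ^ free_count D n = real b powr (- real (free_count D n))"
      using b2 by (simp add: powr_minus_divide powr_realpow)
    also have "\<dots> \<le> real b powr (- s * real n)" using free[OF that] by (intro powr_mono_exponent[OF b2]) simp
    finally show ?thesis by simp
  qed
  have bpow: "(1 / real b ^ n) powr s = real b powr (- s * real n)" for n
    using b2 by (simp add: powr_divide powr_minus_divide powr_powr mult.commute flip: powr_realpow)
  show ?thesis
  proof (cases "U = {}")
    case True
    then show ?thesis by (intro bexI[of _ "{}"]) auto
  next
    case False
    then have dp: "diameter_power s U = ennreal (r powr s)"
      using \<open>s > 0\<close> by (simp add: diameter_power_def r_def)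
    have concl: ?thesis if "J \<in> sets lborel"
      "{t. 0 \<le> t \<and> t < 1 \<and> digit_sum b (spread_digits b D d t) \<in> U} \<subseteq> J"
      "emeasure lborel J \<le> ennreal (C * r powr s + \<epsilon>)" for J
    proof (intro bexI conjI)
      show "emeasure lborel J \<le> ennreal (5 * real b powr (s * (real N0 + 1))) * diameter_power s U + ennreal \<epsilon>"
        using that(3) C \<open>\<epsilon> > 0\<close> unfolding dp C_def[symmetric] by (simp add: ennreal_mult' ennreal_plus)
    qed (rule that)+
    consider "r = 0" | "0 < r" "r < 1 / real b ^ N0" | "r \<ge> 1 / real b ^ N0" using r by linarith
    then show ?thesis
    proof cases
      case 1
      have "\<forall>\<^sub>F n in sequentially. real b powr (- s * real n) < \<epsilon> / 5"
        by (rule order_tendstoD(2)[OF powr_neg_tendsto_0[OF b2 \<open>s > 0\<close>]]) (use \<open>\<epsilon> > 0\<close> in simp)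
      then obtain M where M: "\<And>n. n \<ge> M \<Longrightarrow> real b powr (- s * real n) < \<epsilon> / 5"
        unfolding eventually_sequentially by blast
      let ?N = "max M N0"
      have "diameter U \<le> 1 / real b ^ ?N" using 1 by (simp add: r_def)
      then obtain J where J: "J \<in> sets lborel"
        "{t. 0 \<le> t \<and> t < 1 \<and> digit_sum b (spread_digits b D d t) \<in> U} \<subseteq> J"
        "emeasure lborel J \<le> ennreal (5 / real b ^ free_count D ?N)"
        by (rule spread_digits_level_cover[OF d U])
      have "5 / real b ^ free_count D ?N \<le> \<epsilon>" using level[of ?N] M[of ?N] by simp
      then have "5 / real b ^ free_count D ?N \<le> C * r powr s + \<epsilon>" using 1 by simp
      then show ?thesis by (intro concl[OF J(1,2)] order_trans[OF J(3)] ennreal_leI)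
    next
      case 2
      have "\<exists>n. 1 / real b ^ n < r"
        using real_arch_pow_inv[of r "1 / real b"] 2 b2 by (simp add: power_divide)
      then obtain n where n: "1 / real b ^ n < r" "\<And>m. m < n \<Longrightarrow> \<not> 1 / real b ^ m < r"
        using exists_least_iff[of "\<lambda>n. 1 / real b ^ n < r"] by blast
      have "n > N0"
      proof (rule ccontr)
        assume "\<not> n > N0"
        then have "1 / real b ^ N0 \<le> 1 / real b ^ n" using b2 by (intro divide_left_mono power_increasing) auto
        then show False using n(1) 2 by simp
      qed
      then obtain N where N: "n = Suc N" "N \<ge> N0" by (cases n) auto
      have "diameter U \<le> 1 / real b ^ N" using n(2)[of N] N by (simp add: r_def)
      then obtain J where J: "J \<in> sets lborel"
        "{t. 0 \<le> t \<and> t < 1 \<and> digit_sum b (spread_digits b D d t) \<in> U} \<subseteq> J"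
        "emeasure lborel J \<le> ennreal (5 / real b ^ free_count D N)"
        by (rule spread_digits_level_cover[OF d U])
      have "real b powr (- s * real N) = real b powr s * real b powr (- s * real n)"
        by (simp add: N(1) algebra_simps flip: powr_add)
      also have "\<dots> \<le> real b powr (s * (real N0 + 1)) * r powr s"
      proof (rule mult_mono)
        show "real b powr s \<le> real b powr (s * (real N0 + 1))"
          using \<open>s > 0\<close> by (intro powr_mono_exponent[OF b2]) (simp add: distrib_left)
        show "real b powr (- s * real n) \<le> r powr s"
          unfolding bpow[symmetric] using n(1) \<open>s > 0\<close> by (intro powr_mono2) auto
      qed auto
      finally have "5 / real b ^ free_count D N \<le> C * r powr s + \<epsilon>"
        using level[OF N(2)] \<open>\<epsilon> > 0\<close> by (simp add: C_def)
      then show ?thesis by (intro concl[OF J(1,2)] order_trans[OF J(3)] ennreal_leI)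
    next
      case 3
      have "1 \<le> real b powr s" using b2 \<open>s > 0\<close> by (simp add: ge_one_powr_ge_zero)
      also have "\<dots> = real b powr (s * (real N0 + 1)) * real b powr (- s * real N0)"
        by (simp add: algebra_simps flip: powr_add)
      also have "\<dots> \<le> real b powr (s * (real N0 + 1)) * r powr s"
        unfolding bpow[symmetric] using 3 \<open>s > 0\<close> by (intro mult_left_mono powr_mono2) auto
      finally have "1 \<le> C * r powr s + \<epsilon>" using \<open>\<epsilon> > 0\<close> by (simp add: C_def)
      then have "emeasure lborel {0..1::real} \<le> ennreal (C * r powr s + \<epsilon>)"
        by (simp add: ennreal_leI flip: ennreal_1)
      then show ?thesis by (intro concl[of "{0..1}"]) auto
    qed
  qed
qed

text \<open>A mass distribution argument with Lebesgue measure on t: a cover of A with power sum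
  below 1 / (2 C) would cover [0, 1) by sets of total measure at most 1/2 + 1/4.\<close>

lemma hausdorff_measure_digit_set_pos:
  assumes d: "\<And>i. d i < b" and "s > 0" and free: "\<And>n. n \<ge> N0 \<Longrightarrow> s * real n \<le> real (free_count D n)"
    and A: "\<And>w. (\<And>i. w i < b) \<Longrightarrow> (\<And>i. i \<in> D \<Longrightarrow> w i = d i) \<Longrightarrow> digit_sum b w \<in> A"
  shows "hausdorff_measure s A \<noteq> 0"
proof
  assume null: "hausdorff_measure s A = 0"
  define C where "C = 5 * real b powr (s * (real N0 + 1))"
  have C: "C > 0" using b2 by (simp add: C_def)
  have "hausdorff_premeasure s 1 A \<le> hausdorff_measure s A"
    unfolding hausdorff_measure_def by (intro SUP_upper) auto
  then have "hausdorff_premeasure s 1 A < ennreal (1 / (2 * C))" using null C by simp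
  then obtain U :: "nat \<Rightarrow> real set" where
    U: "U \<in> {U. A \<subseteq> (\<Union>i. U i) \<and> (\<forall>i. bounded (U i) \<and> diameter (U i) \<le> 1)}"
    and less: "(\<Sum>i. diameter_power s (U i)) < ennreal (1 / (2 * C))"
    unfolding hausdorff_premeasure_def by (auto simp only: INF_less_iff)
  define \<epsilon> where "\<epsilon> = (\<lambda>i. 1 / 4 * (1 / 2 :: real) ^ Suc i)"
  define covers where "covers = (\<lambda>i J. J \<in> sets lborel \<and>
    {t. 0 \<le> t \<and> t < 1 \<and> digit_sum b (spread_digits b D d t) \<in> U i} \<subseteq> J \<and>
    emeasure lborel J \<le> ennreal C * diameter_power s (U i) + ennreal (\<epsilon> i))"
  have "\<exists>J. covers i J" for i
  proof -
    have "bounded (U i)" "\<epsilon> i > 0" using U by (auto simp: \<epsilon>_def)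
    then show ?thesis
      unfolding C_def covers_def Bex_def[symmetric] by (intro spread_digits_cover d \<open>s > 0\<close> free)
  qed
  then obtain J where "\<And>i. covers i (J i)" by metis
  then have J: "\<And>i. J i \<in> sets lborel"
    "\<And>i. {t. 0 \<le> t \<and> t < 1 \<and> digit_sum b (spread_digits b D d t) \<in> U i} \<subseteq> J i"
    "\<And>i. emeasure lborel (J i) \<le> ennreal C * diameter_power s (U i) + ennreal (\<epsilon> i)"
    unfolding covers_def by blast+
  have "{0..<1} \<subseteq> (\<Union>i. J i)"
  proof
    fix t :: real assume t: "t \<in> {0..<1}"
    have "digit_sum b (spread_digits b D d t) \<in> A"
      by (rule A) (auto simp: spread_digits_less d, simp add: spread_digits_def)
    then obtain i where "digit_sum b (spread_digits b D d t) \<in> U i" using U by blast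
    then show "t \<in> (\<Union>i. J i)" using t J(2)[of i] by auto
  qed
  then have "emeasure lborel {0..<1::real} \<le> emeasure lborel (\<Union>i. J i)"
    using J(1) by (intro emeasure_mono) auto
  also have "\<dots> \<le> (\<Sum>i. emeasure lborel (J i))"
    using J(1) by (intro emeasure_subadditive_countably) auto
  also have "\<dots> \<le> (\<Sum>i. ennreal C * diameter_power s (U i) + ennreal (\<epsilon> i))"
    by (intro suminf_le J(3)) auto
  also have "\<dots> = (\<Sum>i. ennreal C * diameter_power s (U i)) + (\<Sum>i. ennreal (\<epsilon> i))"
    by (rule suminf_add[symmetric]) auto
  also have "(\<Sum>i. ennreal (\<epsilon> i)) = ennreal (1 / 4)"
    using sums_mult[OF power_half_series, of "1/4"] by (intro suminf_ennreal_eq) (auto simp: \<epsilon>_def)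
  also have "(\<Sum>i. ennreal C * diameter_power s (U i)) = ennreal C * (\<Sum>i. diameter_power s (U i))"
    by (rule ennreal_suminf_cmult)
  also have "ennreal C * (\<Sum>i. diameter_power s (U i)) + ennreal (1 / 4) \<le> ennreal C * ennreal (1 / (2 * C)) + ennreal (1 / 4)"
    using less by (intro add_right_mono mult_left_mono) auto
  also have "\<dots> = ennreal (3 / 4)"
  proof -
    have "ennreal C * ennreal (1 / (2 * C)) = ennreal (1 / 2)"
      using C by (subst ennreal_mult[symmetric]) auto
    moreover have "ennreal (1 / 2) + ennreal (1 / 4) = ennreal (3 / 4)"
      by (subst ennreal_plus[symmetric]) auto
    ultimately show ?thesis by simp
  qed
  finally have "ennreal 1 \<le> ennreal (3 / 4)" by simp
  then show False by (subst (asm) ennreal_le_iff) auto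
qed

end

section \<open>Prescribing two approximation rates\<close>

lemma far_minus: "far c (- t) \<longleftrightarrow> far c t"
proof -
  have "far c (- t)" if "far c t" for t
    unfolding far_def
  proof
    fix m :: int
    have "c \<le> \<bar>t - of_int (- m)\<bar>" using that unfolding far_def by blast
    then show "c \<le> \<bar>- t - of_int m\<bar>" by simp
  qed
  from this[of t] this[of "- t"] show ?thesis by auto
qed

lemma far_perturb:
  assumes "far c t" "\<bar>t - t'\<bar> \<le> e" "c' \<le> c - e"
  shows "far c' t'"
  unfolding far_def
proof
  fix m :: int
  have "c \<le> \<bar>t - of_int m\<bar>" using assms(1) unfolding far_def by blast
  then show "c' \<le> \<bar>t' - of_int m\<bar>" using assms(2,3) by linarith
qed

text \<open>Moving from n to the next square multiplies it by a factor tending to 1, so the grid of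
  squares does not affect approximation exponents.\<close>

lemma eventually_sqrt_plus_1_sq_le:
  assumes "\<kappa> > 1"
  shows "\<forall>\<^sub>F n in sequentially. (sqrt (real n) + 1)\<^sup>2 \<le> \<kappa> * real n"
proof -
  obtain N :: nat where N: "1 / (sqrt \<kappa> - 1) \<le> real N" using real_arch_simple by blast
  have pos: "sqrt \<kappa> > 1" using assms by simp
  have "(sqrt (real n) + 1)\<^sup>2 \<le> \<kappa> * real n" if "n \<ge> N\<^sup>2" for n
  proof -
    have "real N \<le> sqrt (real n)"
      using that by (intro real_le_rsqrt) (simp flip: of_nat_power)
    then have "1 / (sqrt \<kappa> - 1) \<le> sqrt (real n)" using N by linarith
    then have "1 \<le> (sqrt \<kappa> - 1) * sqrt (real n)" using pos by (simp add: pos_divide_le_eq mult.commute)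
    then have "sqrt (real n) + 1 \<le> sqrt \<kappa> * sqrt (real n)" by (simp add: algebra_simps)
    then have "(sqrt (real n) + 1)\<^sup>2 \<le> (sqrt \<kappa> * sqrt (real n))\<^sup>2" by (intro power_mono) auto
    then show ?thesis using assms by (simp add: power_mult_distrib)
  qed
  then show ?thesis unfolding eventually_sequentially by blast
qed

text \<open>The left side bounds the number of positions below n taken by the three-letter words at
  the squares.\<close>

lemma eventually_sqrt_small:
  assumes "\<epsilon> > 0"
  shows "\<forall>\<^sub>F n in sequentially. 3 * (sqrt (real n) + 1) \<le> \<epsilon> * real n"
proof -
  obtain N :: nat where N: "6 / \<epsilon> \<le> real N" using real_arch_simple by blast
  have "3 * (sqrt (real n) + 1) \<le> \<epsilon> * real n" if "n \<ge> N\<^sup>2 + 1" for n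
  proof -
    have "real N \<le> sqrt (real n)"
      using that by (intro real_le_rsqrt) (simp flip: of_nat_power)
    then have "6 / \<epsilon> \<le> sqrt (real n)" using N by linarith
    then have "6 \<le> \<epsilon> * sqrt (real n)" using assms by (simp add: pos_divide_le_eq mult.commute)
    then have "6 * sqrt (real n) \<le> \<epsilon> * sqrt (real n) * sqrt (real n)" by (intro mult_right_mono) auto
    also have "\<dots> = \<epsilon> * real n" by (simp add: mult.assoc)
    finally have "6 * sqrt (real n) \<le> \<epsilon> * real n" .
    moreover have "sqrt (real n) \<ge> 1" using that by simp
    then have "3 * (sqrt (real n) + 1) \<le> 6 * sqrt (real n)" by argo
    ultimately show ?thesis by (rule order_trans[rotated])
  qed
  then show ?thesis unfolding eventually_sequentially by blast
qed

lemma digit_sum_zero [simp]: "digit_sum b (\<lambda>_. 0) = 0"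
  by (simp add: digit_sum_def)

lemma digit_shift_zero [simp]: "digit_shift n (\<lambda>_. 0) = (\<lambda>_. 0)"
  by (simp add: digit_shift_def)

lemma badic_approx_agree:
  assumes b2: "b \<ge> 2" and "\<And>i. w i < b" "\<And>i. w' i < b" "n \<le> m" "\<And>i. n \<le> i \<Longrightarrow> i < m \<Longrightarrow> w i = w' i"
  shows "\<exists>k::int. \<bar>digit_sum b w - digit_sum b w' - of_int k / real b ^ n\<bar> \<le> 1 / real b ^ m"
proof (intro exI[of _ "int (digit_prefix b w n) - int (digit_prefix b w' n)"])
  let ?k = "int (digit_prefix b w n) - int (digit_prefix b w' n)"
  have "real b ^ n * (X - Y - K / real b ^ n) = real b ^ n * X - real b ^ n * Y - K" for X Y K
    using b2 by (simp add: right_diff_distrib)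
  then have "real b ^ n * (digit_sum b w - digit_sum b w' - of_int ?k / real b ^ n) =
      digit_sum b (digit_shift n w) - digit_sum b (digit_shift n w')"
    using digit_sum_prefix[of b w n] digit_sum_prefix[of b w' n] assms by simp
  moreover have "\<bar>digit_sum b (digit_shift n w) - digit_sum b (digit_shift n w')\<bar> \<le> 1 / real b ^ (m - n)"
    by (rule digit_sum_agree) (use assms in \<open>auto simp: digit_shift_def\<close>)
  ultimately have "real b ^ n * \<bar>digit_sum b w - digit_sum b w' - of_int ?k / real b ^ n\<bar> \<le> 1 / real b ^ (m - n)"
    by (metis abs_mult abs_of_nat of_nat_power)
  then have "\<bar>digit_sum b w - digit_sum b w' - of_int ?k / real b ^ n\<bar> \<le> 1 / real b ^ (m - n) / real b ^ n"
    using b2 by (simp only: pos_le_divide_eq[of "real b ^ n"] mult.commute[of _ "real b ^ n"] zero_less_power of_nat_0_less_iff)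
  also have "\<dots> = 1 / real b ^ m" using b2 \<open>n \<le> m\<close> by (simp flip: power_add)
  finally show "\<bar>digit_sum b w - digit_sum b w' - of_int ?k / real b ^ n\<bar> \<le> 1 / real b ^ m" .
qed

text \<open>Positions are grouped into the blocks \<open>[k\<^sup>2, (k + 1)\<^sup>2)\<close>. For \<open>a j \<le> k < c j\<close> the block \<open>k\<close> copies
  the digits of 0 (\<open>j\<close> even) or of the number with digits \<open>\<zeta>\<close> (\<open>j\<close> odd), which produces good \<open>b\<close>-adic
  approximations; every other block starts with a word that prevents them and is free otherwise.\<close>

locale digit_runs =
  fixes b :: nat and \<zeta> :: "nat \<Rightarrow> nat" and u v c1 :: real and \<rho> :: "nat \<Rightarrow> real" and a c :: "nat \<Rightarrow> nat"
  assumes b2: "b \<ge> 2" and \<zeta>_less: "\<And>i. \<zeta> i < b"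
    and u: "0 \<le> u" "u \<le> 1" and v: "0 \<le> v" "v \<le> 1"
    and \<rho>_eq: "\<And>j. \<rho> j = max (if even j then u else v) (1 / (real j + 1))"
    and a_le_c: "\<And>j. a j \<le> c j"
    and c_upper: "\<And>j. \<rho> j * (real (c j))\<^sup>2 \<le> (real (a j))\<^sup>2"
    and c_lower: "\<And>j. real (a j) / sqrt (\<rho> j) - 1 \<le> real (c j)"
    and growth: "\<And>j. (j + 1) * c j < a (Suc j)"
    and a_ge: "\<And>j. j + 3 \<le> a j"
    and c1: "c1 > 0"
    and far_\<zeta>: "\<And>j k. a j \<le> k \<Longrightarrow> k < c j \<Longrightarrow> far c1 (digit_sum b (digit_shift (k\<^sup>2) \<zeta>))"
begin

section \<open>Admissible digit sequences: runs and breaking words\<close>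

definition in_run :: "nat \<Rightarrow> nat \<Rightarrow> bool" where
  "in_run j k \<longleftrightarrow> a j \<le> k \<and> k < c j"

definition model :: "nat \<Rightarrow> nat \<Rightarrow> nat" where
  "model j = (if even j then (\<lambda>_. 0) else \<zeta>)"

text \<open>A block outside the runs has to spoil approximations of x and of x - y at once, so one
  word must avoid both 0 and the tail of \<zeta>.\<close>

definition breaks :: "nat \<Rightarrow> (nat \<Rightarrow> nat) \<Rightarrow> bool" where
  "breaks k e \<longleftrightarrow> (\<forall>i. e i < b) \<and>
     (\<forall>w. (\<forall>i. w i < b) \<longrightarrow> (\<forall>i<3. w i = e i) \<longrightarrow>
       far (1 / real b ^ 3) (digit_sum b w) \<and>
       far (1 / real b ^ 3) (digit_sum b w - digit_sum b (digit_shift (k\<^sup>2) \<zeta>)))"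

definition word :: "nat \<Rightarrow> nat \<Rightarrow> nat" where
  "word k = (SOME e. breaks k e)"

text \<open>\<open>floor_sqrt p\<close> is the number of the block containing p, and 3 is the length
  of the breaking words.\<close>

definition fixed_positions :: "nat set" where
  "fixed_positions = {p. (\<exists>j. in_run j (floor_sqrt p)) \<or> p < (floor_sqrt p)\<^sup>2 + 3}"

definition fixed_digit :: "nat \<Rightarrow> nat" where
  "fixed_digit p =
     (if \<exists>j. in_run j (floor_sqrt p) then model (THE j. in_run j (floor_sqrt p)) p
      else word (floor_sqrt p) (p - (floor_sqrt p)\<^sup>2))"

definition admissible :: "(nat \<Rightarrow> nat) \<Rightarrow> bool" where
  "admissible w \<longleftrightarrow> (\<forall>i. w i < b) \<and> (\<forall>i\<in>fixed_positions. w i = fixed_digit i)"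

lemma breaks_word: "breaks k (word k)"
proof -
  have "0 \<le> digit_sum b (digit_shift (k\<^sup>2) \<zeta>)" "digit_sum b (digit_shift (k\<^sup>2) \<zeta>) \<le> 1"
    using digit_sum_nonneg[OF b2] digit_sum_le_1[OF b2] \<zeta>_less by (simp_all add: digit_shift_def)
  then have "\<exists>e. breaks k e"
    by (rule breaking_word[OF b2]) (auto simp: breaks_def)
  then show ?thesis unfolding word_def by (rule someI_ex)
qed

lemma model_less: "model j i < b"
  using b2 \<zeta>_less by (simp add: model_def)

lemma c_less_a: "i < j \<Longrightarrow> c i < a j"
proof (induction j)
  case (Suc j)
  have "c j \<le> (j + 1) * c j" by simp
  then have "c j < a (Suc j)" using growth[of j] by linarith
  then show ?case using Suc a_le_c[of j] by (cases "i = j") auto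
qed simp

lemma in_run_unique: "in_run i k \<Longrightarrow> in_run j k \<Longrightarrow> i = j"
  using c_less_a[of i j] c_less_a[of j i] by (cases i j rule: linorder_cases) (auto simp: in_run_def)

text \<open>The block following a run thus always carries a breaking word, and the approximation
  produced by the run ends there.\<close>

lemma not_in_run_c: "\<not> in_run i (c j)"
  using c_less_a[of i j] c_less_a[of j i] a_le_c[of j]
  by (cases i j rule: linorder_cases) (auto simp: in_run_def)

lemma fixed_digit_less: "fixed_digit p < b"
  using breaks_word[of "floor_sqrt p"] by (simp add: fixed_digit_def model_less breaks_def)

lemma admissible_less: "admissible w \<Longrightarrow> w i < b"
  by (simp add: admissible_def)

lemma admissible_run:
  assumes "admissible w" "(a j)\<^sup>2 \<le> p" "p < (c j)\<^sup>2"
  shows "w p = model j p"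
proof -
  have run: "in_run j (floor_sqrt p)"
    using assms le_floor_sqrt_iff[of "a j" p] le_floor_sqrt_iff[of "c j" p] by (auto simp: in_run_def)
  then have "(THE j. in_run j (floor_sqrt p)) = j" using in_run_unique by blast
  then have "fixed_digit p = model j p" using run by (auto simp: fixed_digit_def)
  moreover have "p \<in> fixed_positions" using run by (auto simp: fixed_positions_def)
  ultimately show ?thesis using assms by (simp add: admissible_def)
qed

lemma admissible_break:
  assumes w: "admissible w" and "\<And>j. \<not> in_run j k" "k \<ge> 1"
  shows "far (1 / real b ^ 3) (digit_sum b (digit_shift (k\<^sup>2) w) - digit_sum b (digit_shift (k\<^sup>2) (model i)))"
proof -
  have "digit_shift (k\<^sup>2) w r = word k r" if "r < 3" for r
  proof -
    \<comment> \<open>Block k has 2 k + 1 positions, so k \<ge> 1 makes room for the word.\<close>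
    have "floor_sqrt (r + k\<^sup>2) = k"
      using that \<open>k \<ge> 1\<close> by (intro floor_sqrt_unique) (simp_all add: power2_eq_square)
    then have "r + k\<^sup>2 \<in> fixed_positions" "fixed_digit (r + k\<^sup>2) = word k r"
      using that assms by (auto simp: fixed_positions_def fixed_digit_def)
    then show ?thesis using w by (simp add: admissible_def digit_shift_def)
  qed
  moreover have "digit_shift (k\<^sup>2) w r < b" for r using admissible_less[OF w] by (simp add: digit_shift_def)
  ultimately have "far (1 / real b ^ 3) (digit_sum b (digit_shift (k\<^sup>2) w))"
    "far (1 / real b ^ 3) (digit_sum b (digit_shift (k\<^sup>2) w) - digit_sum b (digit_shift (k\<^sup>2) \<zeta>))"
    using breaks_word[of k] unfolding breaks_def by blast+
  then show ?thesis by (simp add: model_def)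
qed

text \<open>In a run of the other parity x copies the other model, from which model i is far by
  \<open>far_\<zeta>\<close>. Copying k digits of the block already makes the error at most
  b^(-k).\<close>

lemma admissible_other_run:
  assumes w: "admissible w" and "in_run j k" "even i \<noteq> even j" "c' \<le> c1 - 1 / real b ^ k"
  shows "far c' (digit_sum b (digit_shift (k\<^sup>2) w) - digit_sum b (digit_shift (k\<^sup>2) (model i)))"
proof -
  let ?T = "\<lambda>w. digit_sum b (digit_shift (k\<^sup>2) w)"
  have "digit_shift (k\<^sup>2) w r = digit_shift (k\<^sup>2) (model j) r" if "r < k" for r
    unfolding digit_shift_def
  proof (rule admissible_run[OF w])
    show "(a j)\<^sup>2 \<le> r + k\<^sup>2" using assms(2) by (simp add: in_run_def power_mono trans_le_add2)
    have "r + k\<^sup>2 < (Suc k)\<^sup>2" using that by (simp add: power2_eq_square)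
    also have "\<dots> \<le> (c j)\<^sup>2" using assms(2) by (intro power_mono) (auto simp: in_run_def)
    finally show "r + k\<^sup>2 < (c j)\<^sup>2" .
  qed
  then have "\<bar>?T w - ?T (model j)\<bar> \<le> 1 / real b ^ k"
    by (intro digit_sum_agree[OF b2]) (auto simp: digit_shift_def model_less admissible_less[OF w])
  moreover have "far c1 (?T (model j) - ?T (model i))"
    using far_\<zeta>[of j k] assms(2,3) by (cases "even j") (auto simp: model_def in_run_def far_minus)
  ultimately show ?thesis
    using assms(4) by (elim far_perturb) (auto simp: abs_minus_commute)
qed

section \<open>Approximation exponents of admissible numbers\<close>

abbreviation rate :: "nat \<Rightarrow> real" where
  "rate i \<equiv> if even i then u else v"

lemma rate_bounds: "0 \<le> rate i" "rate i \<le> 1"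
  using u v by auto

lemma \<rho>_bounds: "rate i \<le> \<rho> i" "0 < \<rho> i" "\<rho> i \<le> 1"
  using u v by (auto simp: \<rho>_eq less_max_iff_disj)

lemma rate_cong: "even i = even j \<Longrightarrow> rate i = rate j"
  by simp

text \<open>The far position is k^2 itself, except inside a run copying the same model, where it is
  the end (c j)^2. There \<open>c_upper\<close> gives rate (c j)^2 \<le> (a j)^2 \<le> k^2, which
  limits the exponent to 1 / rate.\<close>

lemma admissible_far_level:
  assumes w: "admissible w"
  obtains c0 k0 where "c0 > 0" "\<And>k. k \<ge> k0 \<Longrightarrow> \<exists>p\<ge>k\<^sup>2. rate i * real p \<le> (real k)\<^sup>2 \<and>
    far c0 (digit_sum b (digit_shift p w) - digit_sum b (digit_shift p (model i)))"
proof -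
  \<comment> \<open>The first entry comes from the breaking words; in the second, half of
    \<open>c1\<close> is given up to the copying error b^(-k).\<close>
  define c0 where "c0 = min (1 / real b ^ 3) (c1 / 2)"
  have far_c0: "far (1 / real b ^ 3) t \<Longrightarrow> far c0 t" for t
    by (rule far_perturb[where e = 0]) (auto simp: c0_def)
  obtain k1 where k1: "(1 / real b) ^ k1 < c1 / 2"
    using real_arch_pow_inv[of "c1 / 2" "1 / real b"] c1 b2 by auto
  have small: "1 / real b ^ k \<le> c1 / 2" if "k \<ge> k1" for k
  proof -
    have "1 / real b ^ k \<le> 1 / real b ^ k1" using that b2 by (intro divide_left_mono power_increasing) auto
    then show ?thesis using k1 by (simp add: power_divide)
  qed
  show thesis
  proof (rule that[of c0 "max 1 k1"])
    show "c0 > 0" using b2 c1 by (simp add: c0_def)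
    fix k assume k: "k \<ge> max 1 k1"
    have rate_sq: "rate i * real (k\<^sup>2) \<le> (real k)\<^sup>2"
      using rate_bounds[of i] mult_right_mono[of "rate i" 1 "real (k\<^sup>2)"] by simp
    consider "\<And>j. \<not> in_run j k" | j where "in_run j k" "even i \<noteq> even j" | j where "in_run j k" "even i = even j"
      by blast
    then show "\<exists>p\<ge>k\<^sup>2. rate i * real p \<le> (real k)\<^sup>2 \<and>
      far c0 (digit_sum b (digit_shift p w) - digit_sum b (digit_shift p (model i)))"
    proof cases
      case 1
      then show ?thesis using far_c0[OF admissible_break[OF w 1, of i]] rate_sq k by (intro exI[of _ "k\<^sup>2"]) auto
    next
      case 2
      have "c0 \<le> c1 - 1 / real b ^ k" using small[of k] k by (simp add: c0_def)
      then show ?thesis using admissible_other_run[OF w 2] rate_sq by (intro exI[of _ "k\<^sup>2"]) auto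
    next
      case 3
      have "c j \<ge> 1" using a_ge[of j] a_le_c[of j] by linarith
      then have "far c0 (digit_sum b (digit_shift ((c j)\<^sup>2) w) - digit_sum b (digit_shift ((c j)\<^sup>2) (model i)))"
        by (intro far_c0 admissible_break[OF w not_in_run_c])
      moreover have "k\<^sup>2 \<le> (c j)\<^sup>2" using 3 by (intro power_mono) (auto simp: in_run_def)
      moreover have "rate i * real ((c j)\<^sup>2) \<le> (real k)\<^sup>2"
      proof -
        have "rate i * real ((c j)\<^sup>2) \<le> \<rho> j * real ((c j)\<^sup>2)"
          using \<rho>_bounds(1)[of j] rate_cong[OF 3(2)] by (intro mult_right_mono) auto
        also have "\<dots> \<le> (real (a j))\<^sup>2" using c_upper[of j] by simp
        also have "\<dots> \<le> (real k)\<^sup>2" using 3 by (intro power_mono) (auto simp: in_run_def)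
        finally show ?thesis .
      qed
      ultimately show ?thesis by blast
    qed
  qed
qed

lemma admissible_badly_approx:
  assumes w: "admissible w" and \<tau>: "\<tau> * rate i > 1"
  shows "badly_approx b \<tau> (digit_sum b w - digit_sum b (model i))"
proof -
  obtain c0 k0 where c0: "c0 > 0" and far: "\<And>k. k \<ge> k0 \<Longrightarrow> \<exists>p\<ge>k\<^sup>2. rate i * real p \<le> (real k)\<^sup>2 \<and>
    far c0 (digit_sum b (digit_shift p w) - digit_sum b (digit_shift p (model i)))"
    using admissible_far_level[OF w, where i = i] by blast
  have rate_pos: "rate i > 0" using \<tau> rate_bounds[of i] by (cases "rate i = 0") auto
  then have "\<tau> > 0" using \<tau> by (metis less_trans zero_less_mult_pos2 zero_less_one)
  obtain N where N: "\<And>n. n \<ge> N \<Longrightarrow> (sqrt (real n) + 1)\<^sup>2 \<le> \<tau> * rate i * real n"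
    using eventually_sqrt_plus_1_sq_le[OF \<tau>] unfolding eventually_sequentially by blast
  show ?thesis
  proof (rule badly_approxI[OF b2 c0])
    show "\<tau> \<ge> 0" using \<open>\<tau> > 0\<close> by simp
    fix n and m :: int
    assume n: "n \<ge> max N (k0\<^sup>2)"
    \<comment> \<open>The first block beginning after level n: being far at p \<ge> k^2 > n controls
      level n, and p is at most about n / rate.\<close>
    define k where "k = Suc (floor_sqrt n)"
    have "k0 \<le> k" using n by (simp add: k_def le_floor_sqrt_iff le_SucI)
    then obtain p where p: "p \<ge> k\<^sup>2" "rate i * real p \<le> (real k)\<^sup>2"
      "far c0 (digit_sum b (digit_shift p w) - digit_sum b (digit_shift p (model i)))"
      using far by blast
    have "real (floor_sqrt n) \<le> sqrt (real n)" by (intro real_le_rsqrt) (simp flip: of_nat_power)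
    then have "(real k)\<^sup>2 \<le> (sqrt (real n) + 1)\<^sup>2" by (intro power_mono) (auto simp: k_def)
    also have "\<dots> \<le> \<tau> * rate i * real n" using N n by simp
    finally have "rate i * real p \<le> rate i * (\<tau> * real n)" using p(2) by (simp add: mult_ac)
    then have p_le: "real p \<le> \<tau> * real n" using rate_pos by (simp only: mult_le_cancel_left_pos)
    have "n \<le> p" using Suc_floor_sqrt_power2_gt[of n] p(1) unfolding k_def by linarith
    have "real b powr (- \<tau> * real n) \<le> real b powr (- real p)"
      using p_le by (intro powr_mono_exponent[OF b2]) simp
    then have "c0 * real b powr (- \<tau> * real n) \<le> c0 * real b powr (- real p)"
      using c0 by (intro mult_left_mono) auto
    also have "\<dots> = c0 / real b ^ p" using b2 by (simp add: powr_minus_divide powr_realpow)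
    also have "\<dots> \<le> \<bar>digit_sum b w - digit_sum b (model i) - of_int m / real b ^ n\<bar>"
      by (rule far_badic_distance[OF b2 admissible_less[OF w] model_less p(3) \<open>n \<le> p\<close>])
    finally show "c0 * real b powr (- \<tau> * real n) \<le> \<bar>digit_sum b w - digit_sum b (model i) - of_int m / real b ^ n\<bar>" .
  qed
qed

text \<open>Run j copies its model from (a j)^2 to (c j)^2, whose ratio is about
  \<open>1 / \<rho> j\<close>, and runs of the parity of i recur infinitely often.\<close>

lemma admissible_well_approx:
  assumes w: "admissible w" and \<tau>: "\<tau> > 0" "\<tau> * rate i < 1"
  shows "well_approx b \<tau> (digit_sum b w - digit_sum b (model i))"
  unfolding well_approx_def INFM_nat_le
proof (intro allI)
  fix m :: nat
  have "rate i < 1 / \<tau>" using \<tau> by (simp add: pos_less_divide_eq mult.commute)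
  \<comment> \<open>An intermediate rate leaves room for both deviations of run j: the lower bound 1
    / (j + 1) on \<open>\<rho> j\<close>, beaten by M1, and the rounding of \<open>c j\<close>,
    beaten by M2 through \<kappa>.\<close>
  then obtain \<rho>' where \<rho>': "rate i < \<rho>'" "\<rho>' < 1 / \<tau>" using dense by blast
  then have "\<rho>' > 0" using rate_bounds[of i] by linarith
  have "\<tau> * \<rho>' < 1" using \<rho>' \<tau> by (simp add: pos_less_divide_eq mult.commute)
  then have "sqrt \<tau> * sqrt \<rho>' < 1" by (simp flip: real_sqrt_mult)
  then have "sqrt \<tau> < 1 / sqrt \<rho>'" using \<open>\<rho>' > 0\<close> by (simp add: pos_less_divide_eq)
  define \<kappa> where "\<kappa> = 1 / sqrt \<rho>' - sqrt \<tau>"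
  have "\<kappa> > 0" using \<open>sqrt \<tau> < 1 / sqrt \<rho>'\<close> by (simp add: \<kappa>_def)
  obtain M1 :: nat where M1: "1 / \<rho>' \<le> real M1" using real_arch_simple by blast
  obtain M2 :: nat where M2: "1 / \<kappa> \<le> real M2" using real_arch_simple by blast
  define j where "j = 2 * (m + M1 + M2) + (if even i then 0 else 1)"
  have parity: "even i = even j" by (simp add: j_def)
  have j: "m \<le> j" "M1 \<le> j" "M2 \<le> j" by (auto simp: j_def)
  have "\<rho> j \<le> \<rho>'"
  proof -
    have "1 / \<rho>' \<le> real j + 1" using M1 j by linarith
    then have "1 / (real j + 1) \<le> \<rho>'"
      using \<open>\<rho>' > 0\<close> by (simp add: pos_divide_le_eq mult.commute)
    then show ?thesis using \<rho>' unfolding \<rho>_eq rate_cong[OF parity, symmetric] by simp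
  qed
  have aj: "j \<le> a j" using a_ge[of j] by simp
  have "sqrt \<tau> * real (a j) \<le> real (c j)"
  proof -
    have "1 / \<kappa> \<le> real (a j)" using M2 j aj by linarith
    then have "1 \<le> \<kappa> * real (a j)" using \<open>\<kappa> > 0\<close> by (simp add: pos_divide_le_eq mult.commute)
    then have "sqrt \<tau> * real (a j) \<le> real (a j) / sqrt \<rho>' - 1" by (simp add: \<kappa>_def left_diff_distrib)
    also have "\<dots> \<le> real (a j) / sqrt (\<rho> j) - 1"
      using \<open>\<rho> j \<le> \<rho>'\<close> \<rho>_bounds(2)[of j] by (intro diff_right_mono divide_left_mono) auto
    also have "\<dots> \<le> real (c j)" by (rule c_lower)
    finally show ?thesis .
  qed
  then have "(sqrt \<tau> * real (a j))\<^sup>2 \<le> (real (c j))\<^sup>2" using \<tau> by (intro power_mono) auto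
  then have ac: "\<tau> * real ((a j)\<^sup>2) \<le> real ((c j)\<^sup>2)" using \<tau> by (simp add: power_mult_distrib)
  have model: "model i = model j" using parity by (simp add: model_def)
  obtain k :: int where k: "\<bar>digit_sum b w - digit_sum b (model j) - of_int k / real b ^ ((a j)\<^sup>2)\<bar> \<le> 1 / real b ^ ((c j)\<^sup>2)"
    using badic_approx_agree[of b w "model j" "(a j)\<^sup>2" "(c j)\<^sup>2"] b2 model_less
      admissible_less[OF w] admissible_run[OF w, of j] a_le_c[of j] by (auto intro: power_mono)
  have "1 / real b ^ ((c j)\<^sup>2) = real b powr (- real ((c j)\<^sup>2))"
    using b2 by (simp add: powr_minus_divide powr_realpow del: of_nat_power)
  also have "\<dots> \<le> real b powr (- \<tau> * real ((a j)\<^sup>2))"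
    using ac by (intro powr_mono_exponent[OF b2]) simp
  finally have "\<bar>digit_sum b w - digit_sum b (model i) - of_int k / real b ^ ((a j)\<^sup>2)\<bar> \<le> real b powr (- \<tau> * real ((a j)\<^sup>2))"
    using k model by simp
  moreover have "m \<le> (a j)\<^sup>2"
  proof -
    have "a j \<le> (a j)\<^sup>2" by (simp add: power2_eq_square)
    then show ?thesis using j aj by linarith
  qed
  ultimately show "\<exists>n\<ge>m. \<exists>k::int. \<bar>digit_sum b w - digit_sum b (model i) - of_int k / real b ^ n\<bar> \<le> real b powr (- \<tau> * real n)"
    by blast
qed

section \<open>Counting the free positions\<close>

lemma fixed_positions_below:
  assumes "n < (a (Suc (Suc i)))\<^sup>2"
  shows "fixed_positions \<inter> {..<n} \<subseteq> (\<lambda>(k, r). k\<^sup>2 + r) ` ({..floor_sqrt n} \<times> {..<3}) \<union> {..<(c i)\<^sup>2}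
    \<union> {(a (Suc i))\<^sup>2..<min n ((c (Suc i))\<^sup>2)}"
proof
  fix p assume p: "p \<in> fixed_positions \<inter> {..<n}"
  define k where "k = floor_sqrt p"
  have k: "k\<^sup>2 \<le> p" "p < (Suc k)\<^sup>2" "k \<le> floor_sqrt n"
    using p Suc_floor_sqrt_power2_gt[of p] by (auto simp: k_def intro!: mono_floor_sqrt')
  consider "p < k\<^sup>2 + 3" | j where "in_run j k"
    using p by (auto simp: fixed_positions_def k_def)
  then show "p \<in> (\<lambda>(k, r). k\<^sup>2 + r) ` ({..floor_sqrt n} \<times> {..<3}) \<union> {..<(c i)\<^sup>2}
    \<union> {(a (Suc i))\<^sup>2..<min n ((c (Suc i))\<^sup>2)}"
  proof cases
    case 1
    then have "p = (\<lambda>(k, r). k\<^sup>2 + r) (k, p - k\<^sup>2)" "(k, p - k\<^sup>2) \<in> {..floor_sqrt n} \<times> {..<3}" using k by auto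
    then show ?thesis by blast
  next
    case 2
    have "(Suc k)\<^sup>2 \<le> (c j)\<^sup>2" "(a j)\<^sup>2 \<le> k\<^sup>2" using 2 by (auto simp: in_run_def intro!: power_mono)
    then have pj: "p < (c j)\<^sup>2" "(a j)\<^sup>2 \<le> p" using k by linarith+
    have "j < Suc (Suc i)"
    proof (rule ccontr)
      assume "\<not> j < Suc (Suc i)"
      then have "a (Suc (Suc i)) \<le> a j"
        using c_less_a[of "Suc (Suc i)" j] a_le_c[of "Suc (Suc i)"] by (cases "j = Suc (Suc i)") auto
      then have "(a (Suc (Suc i)))\<^sup>2 \<le> (a j)\<^sup>2" by (intro power_mono) auto
      then have "n < p" using pj(2) assms by linarith
      then show False using p by simp
    qed
    then consider "j = Suc i" | "j \<le> i" by linarith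
    then show ?thesis
    proof cases
      case 1 then show ?thesis using pj p by auto
    next
      case 2
      then have "c j \<le> c i" using c_less_a[of j i] a_le_c[of i] by (cases "j = i") auto
      then have "(c j)\<^sup>2 \<le> (c i)\<^sup>2" by (intro power_mono) auto
      then have "p < (c i)\<^sup>2" using pj by linarith
      then show ?thesis by blast
    qed
  qed
qed

text \<open>The worst n is the end of a run, where a proportion of about \<rho> is free; words fill
  o(n) positions, and by \<open>growth\<close> all earlier runs lie below n / (i + 1)^2. Only one
  run matters at a time, hence the minimum of u and v.\<close>

lemma fixed_positions_sparse:
  assumes "s < min u v"
  shows "\<exists>N0. \<forall>n\<ge>N0. s * real n \<le> real (free_count fixed_positions n)"
proof -
  define \<mu> where "\<mu> = min u v"
  \<comment> \<open>One \<epsilon> is spent on the words and one on the earlier runs.\<close>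
  define \<epsilon> where "\<epsilon> = (\<mu> - s) / 2"
  have "\<epsilon> > 0" using assms by (simp add: \<epsilon>_def \<mu>_def)
  have \<mu>: "0 \<le> \<mu>" "\<mu> \<le> rate j" for j using u v by (auto simp: \<mu>_def)
  obtain J :: nat where J: "1 / \<epsilon> \<le> real J" using real_arch_simple by blast
  obtain N1 where N1: "\<And>n. n \<ge> N1 \<Longrightarrow> 3 * (sqrt (real n) + 1) \<le> \<epsilon> * real n"
    using eventually_sqrt_small[OF \<open>\<epsilon> > 0\<close>] unfolding eventually_sequentially by blast
  have "s * real n \<le> real (free_count fixed_positions n)" if n: "n \<ge> max N1 ((a (Suc J))\<^sup>2)" for n
  proof -
    have "n < (a (Suc n))\<^sup>2"
    proof -
      have "n < a (Suc n)" using a_ge[of "Suc n"] by linarith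
      also have "\<dots> \<le> (a (Suc n))\<^sup>2" by (simp add: power2_eq_square)
      finally show ?thesis .
    qed
    then obtain j where j: "n < (a j)\<^sup>2" "\<And>j'. j' < j \<Longrightarrow> \<not> n < (a j')\<^sup>2"
      using exists_least_iff[of "\<lambda>j. n < (a j)\<^sup>2"] by blast
    have "Suc J < j"
    proof (rule ccontr)
      assume "\<not> Suc J < j"
      then have "a j \<le> a (Suc J)" using c_less_a[of j "Suc J"] a_le_c[of j] by (cases "j = Suc J") auto
      then have "(a j)\<^sup>2 \<le> (a (Suc J))\<^sup>2" by (intro power_mono) auto
      then have "n < (a (Suc J))\<^sup>2" using j(1) by linarith
      then show False using n by simp
    qed
    then obtain i where i: "j = Suc (Suc i)" "J \<le> i"
      by (metis Suc_le_D Suc_le_eq Suc_le_mono less_imp_le)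
    have ai: "(a (Suc i))\<^sup>2 \<le> n" using j(2)[of "Suc i"] i by simp
    let ?S1 = "(\<lambda>(k, r). k\<^sup>2 + r) ` ({..floor_sqrt n} \<times> {..<3::nat})"
    let ?S2 = "{..<(c i)\<^sup>2}"
    let ?S3 = "{(a (Suc i))\<^sup>2..<min n ((c (Suc i))\<^sup>2)}"
    have "card (fixed_positions \<inter> {..<n}) \<le> card (?S1 \<union> ?S2 \<union> ?S3)"
      using fixed_positions_below[of n i] j i by (intro card_mono) auto
    also have "\<dots> \<le> card ?S1 + card ?S2 + card ?S3"
      using card_Un_le[of "?S1 \<union> ?S2" ?S3] card_Un_le[of ?S1 ?S2] by linarith
    finally have card: "real (card (fixed_positions \<inter> {..<n})) \<le> real (card ?S1) + real (card ?S2) + real (card ?S3)"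
      by linarith
    have "card ?S1 \<le> card ({..floor_sqrt n} \<times> {..<3::nat})" by (intro card_image_le) auto
    also have "\<dots> = 3 * (floor_sqrt n + 1)" by simp
    finally have "real (card ?S1) \<le> real (3 * (floor_sqrt n + 1))" by (simp only: of_nat_le_iff)
    then have "real (card ?S1) \<le> 3 * (real (floor_sqrt n) + 1)" by simp
    moreover have "real (floor_sqrt n) \<le> sqrt (real n)" by (intro real_le_rsqrt) (simp flip: of_nat_power)
    ultimately have S1: "real (card ?S1) \<le> \<epsilon> * real n" using N1[of n] n by simp
    have S2: "real (card ?S2) \<le> \<epsilon> * real n"
    proof -
      have "((i + 1) * c i)\<^sup>2 \<le> (a (Suc i))\<^sup>2" using growth[of i] by (intro power_mono) auto
      also have "\<dots> \<le> n" by (rule ai)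
      finally have "real (((i + 1) * c i)\<^sup>2) \<le> real n" by (simp only: of_nat_le_iff)
      moreover have "real (((i + 1) * c i)\<^sup>2) = ((real i + 1) * real (c i))\<^sup>2"
        by (simp only: of_nat_power of_nat_mult of_nat_add of_nat_1)
      ultimately have le: "(real i + 1)\<^sup>2 * (real (c i))\<^sup>2 \<le> real n" by (simp only: power_mult_distrib)
      have "1 / \<epsilon> \<le> real i + 1" using J i by linarith
      then have "1 \<le> \<epsilon> * (real i + 1)" using \<open>\<epsilon> > 0\<close> by (simp add: pos_divide_le_eq mult.commute)
      also have "\<dots> \<le> \<epsilon> * (real i + 1)\<^sup>2" using \<open>\<epsilon> > 0\<close> by (intro mult_left_mono) (auto simp: power2_eq_square)
      finally have "1 * (real (c i))\<^sup>2 \<le> \<epsilon> * (real i + 1)\<^sup>2 * (real (c i))\<^sup>2" by (intro mult_right_mono) auto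
      also have "\<dots> \<le> \<epsilon> * real n" using le \<open>\<epsilon> > 0\<close> by (simp add: mult.assoc)
      finally show ?thesis by simp
    qed
    \<comment> \<open>For n \<le> C one has A \<ge> \<mu> C \<ge> \<mu> n; behind the run the fixed
      part stays at C - A while n grows.\<close>
    have S3: "real (card ?S3) \<le> (1 - \<mu>) * real n"
    proof -
      define A C where "A = real ((a (Suc i))\<^sup>2)" and "C = real ((c (Suc i))\<^sup>2)"
      have AC: "\<rho> (Suc i) * C \<le> A" using c_upper[of "Suc i"] by (simp add: A_def C_def)
      have "\<mu> \<le> \<rho> (Suc i)" using \<mu>(2)[of "Suc i"] \<rho>_bounds(1)[of "Suc i"] by linarith
      moreover have "C \<ge> 0" by (simp add: C_def)
      ultimately have \<mu>C: "\<mu> * C \<le> A" using AC mult_right_mono[of \<mu> "\<rho> (Suc i)" C] by linarith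
      have "(a (Suc i))\<^sup>2 \<le> (c (Suc i))\<^sup>2" using a_le_c by (intro power_mono) auto
      then have "real (card ?S3) = min (real n) C - A"
        using ai by (simp add: A_def C_def of_nat_diff of_nat_min)
      moreover have "\<mu> \<le> 1" using u by (simp add: \<mu>_def)
      ultimately show ?thesis
      proof (cases "real n \<le> C")
        case True
        have "\<mu> * real n \<le> \<mu> * C" using True \<mu>(1) by (intro mult_left_mono)
        then show ?thesis using True \<mu>C \<open>real (card ?S3) = min (real n) C - A\<close> by (simp add: left_diff_distrib)
      next
        case False
        have "(1 - \<mu>) * C \<le> (1 - \<mu>) * real n" using False \<open>\<mu> \<le> 1\<close> by (intro mult_left_mono) auto
        then show ?thesis using False \<mu>C \<open>real (card ?S3) = min (real n) C - A\<close> by (simp add: left_diff_distrib)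
      qed
    qed
    have "free_count fixed_positions n = n - card (fixed_positions \<inter> {..<n})"
    proof -
      have "{..<n} - fixed_positions = {..<n} - (fixed_positions \<inter> {..<n})" by auto
      then show ?thesis unfolding free_count_def by (simp add: card_Diff_subset)
    qed
    then have "real n - real (card (fixed_positions \<inter> {..<n})) \<le> real (free_count fixed_positions n)" by linarith
    moreover have "s * real n = \<mu> * real n - 2 * (\<epsilon> * real n)"
    proof -
      have "s = \<mu> - 2 * \<epsilon>" by (simp add: \<epsilon>_def field_simps)
      then show ?thesis by (simp only: left_diff_distrib mult.assoc)
    qed
    ultimately show ?thesis using card S1 S2 S3 by (simp add: left_diff_distrib)
  qed
  then show ?thesis by blast
qed

end

section \<open>The translation parameter\<close>

text \<open>Runs are chosen greedily, each start depending on the previous end. Blocks are numbered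
  by square roots of positions, so a ratio 1 / \<rho> of positions becomes 1 / sqrt \<rho>. A rate 0
  would require infinite runs; cutting \<open>\<rho> j\<close> off at 1 / (j + 1) makes them finite
  with unbounded ratios, and so \<zeta> must be far over stretches of every ratio K.\<close>

lemma exists_digit_runs:
  fixes u v c1 :: real
  assumes "b \<ge> 2" "\<And>i. \<zeta> i < b" "0 \<le> u" "u \<le> 1" "0 \<le> v" "v \<le> 1" "c1 > 0"
    and far: "\<And>K N. \<exists>a\<ge>N. \<forall>k. a \<le> k \<and> real k \<le> K * real a \<longrightarrow>
      far c1 (digit_sum b (digit_shift (k\<^sup>2) \<zeta>))"
  obtains \<rho> a c where "digit_runs b \<zeta> u v c1 \<rho> a c"
proof -
  define \<rho> where "\<rho> = (\<lambda>j. max (if even j then u else v) (1 / (real j + 1)))"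
  define c where "c = (\<lambda>j x. nat \<lfloor>real x / sqrt (\<rho> j)\<rfloor>)"
  have \<rho>: "0 < \<rho> j" "\<rho> j \<le> 1" for j using assms by (auto simp: \<rho>_def less_max_iff_disj)
  have c_le: "real (c j x) \<le> real x / sqrt (\<rho> j)" and c_ge: "real x / sqrt (\<rho> j) - 1 \<le> real (c j x)" for j x
  proof -
    have "0 \<le> real x / sqrt (\<rho> j)" using \<rho>[of j] by simp
    then show "real (c j x) \<le> real x / sqrt (\<rho> j)" "real x / sqrt (\<rho> j) - 1 \<le> real (c j x)"
      unfolding c_def by linarith+
  qed
  define good where "good = (\<lambda>j x. j + 3 \<le> x \<and>
    (\<forall>k. x \<le> k \<and> k < c j x \<longrightarrow> far c1 (digit_sum b (digit_shift (k\<^sup>2) \<zeta>))))"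
  have good_ex: "\<exists>x\<ge>N. good j x" for j N
  proof -
    obtain x where x: "x \<ge> max N (j + 3)" "\<And>k. x \<le> k \<Longrightarrow> real k \<le> 1 / sqrt (\<rho> j) * real x \<Longrightarrow>
      far c1 (digit_sum b (digit_shift (k\<^sup>2) \<zeta>))"
      using far[of "max N (j + 3)" "1 / sqrt (\<rho> j)"] by blast
    have "far c1 (digit_sum b (digit_shift (k\<^sup>2) \<zeta>))" if "x \<le> k" "k < c j x" for k
    proof (rule x(2)[OF that(1)])
      have "real k \<le> real (c j x)" using that by simp
      then show "real k \<le> 1 / sqrt (\<rho> j) * real x" using c_le[of j x] by simp
    qed
    then show ?thesis using x(1) by (intro exI[of _ x]) (auto simp: good_def)
  qed
  have "\<exists>a. \<forall>j. good j (a j) \<and> (j + 1) * c j (a j) < a (Suc j)"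
  proof (rule dependent_nat_choice)
    show "\<exists>x. good 0 x" using good_ex by blast
    fix x j
    obtain x' where "x' \<ge> Suc ((j + 1) * c j x)" "good (Suc j) x'" using good_ex by blast
    then show "\<exists>y. good (Suc j) y \<and> (j + 1) * c j x < y" by (intro exI[of _ x']) auto
  qed
  then obtain a where a: "\<And>j. good j (a j)" "\<And>j. (j + 1) * c j (a j) < a (Suc j)" by blast
  have "digit_runs b \<zeta> u v c1 \<rho> a (\<lambda>j. c j (a j))"
  proof
    fix j k
    show "b \<ge> 2" "\<zeta> j < b" "0 \<le> u" "u \<le> 1" "0 \<le> v" "v \<le> 1" "c1 > 0" by (fact assms)+
    show "\<rho> j = max (if even j then u else v) (1 / (real j + 1))" by (simp add: \<rho>_def)
    show "a j \<le> c j (a j)"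
    proof -
      have "real (a j) * sqrt (\<rho> j) \<le> real (a j)" using \<rho>[of j] by (intro mult_left_le) auto
      then have "real (a j) \<le> real (a j) / sqrt (\<rho> j)" using \<rho>[of j] by (simp add: pos_le_divide_eq)
      then show ?thesis unfolding c_def by (intro le_nat_floor) simp
    qed
    show "\<rho> j * (real (c j (a j)))\<^sup>2 \<le> (real (a j))\<^sup>2"
    proof -
      have "real (c j (a j)) * sqrt (\<rho> j) \<le> real (a j)"
        using c_le[of j "a j"] \<rho>[of j] by (simp add: pos_le_divide_eq)
      then have "(real (c j (a j)) * sqrt (\<rho> j))\<^sup>2 \<le> (real (a j))\<^sup>2"
        using \<rho>[of j] by (intro power_mono) auto
      then show ?thesis using \<rho>[of j] by (simp add: power_mult_distrib mult.commute)
    qed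
    show "real (a j) / sqrt (\<rho> j) - 1 \<le> real (c j (a j))" by (rule c_ge)
    show "(j + 1) * c j (a j) < a (Suc j)" by (rule a(2))
    show "j + 3 \<le> a j" using a(1)[of j] by (simp add: good_def)
    show "far c1 (digit_sum b (digit_shift (k\<^sup>2) \<zeta>))" if "a j \<le> k" "k < c j (a j)"
      using a(1)[of j] that by (simp add: good_def)
  qed
  then show thesis by (rule that)
qed

text \<open>Scaled by b^2 the number lies in [1, 2] or [b, b + 1], at distance at least 1 from 0 and
  from b^2 whatever the remaining digits are.\<close>

lemma far_if_digits_01:
  assumes b2: "b \<ge> 2" and w: "\<And>i. w i < b" and w01: "w 0 = 1 \<and> w 1 = 0 \<or> w 0 = 0 \<and> w 1 = 1"
  shows "far (1 / real b ^ 2) (digit_sum b w)"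
  unfolding far_def
proof
  fix m :: int
  define X where "X = real b ^ 2 * digit_sum b w"
  define e where "e = digit_sum b (digit_shift 2 w)"
  have "0 \<le> e" "e \<le> 1"
    using digit_sum_nonneg[OF b2] digit_sum_le_1[OF b2] w by (simp_all add: e_def digit_shift_def)
  have "digit_prefix b w 2 = b * w 0 + w 1" by (simp add: eval_nat_numeral)
  then have X: "X = real b * real (w 0) + real (w 1) + e"
    using digit_sum_prefix[OF b2, of w 2] w by (simp add: X_def e_def)
  have b_sq: "real b ^ 2 \<ge> 2 * real b" using b2 by (simp add: power2_eq_square)
  have "1 \<le> X" "X \<le> real b ^ 2 - 1"
    using X w01 \<open>0 \<le> e\<close> \<open>e \<le> 1\<close> b_sq b2 by auto
  consider "m \<le> 0" | "m \<ge> 1" by linarith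
  then have "1 \<le> \<bar>X - real b ^ 2 * of_int m\<bar>"
  proof cases
    case 1
    then have "real b ^ 2 * of_int m \<le> 0" by (simp add: mult_nonneg_nonpos)
    then show ?thesis using \<open>1 \<le> X\<close> by linarith
  next
    case 2
    then have "real b ^ 2 * 1 \<le> real b ^ 2 * of_int m" by (intro mult_left_mono) auto
    then show ?thesis using \<open>X \<le> real b ^ 2 - 1\<close> by linarith
  qed
  also have "\<dots> = real b ^ 2 * \<bar>digit_sum b w - of_int m\<bar>"
    by (simp add: X_def abs_mult flip: right_diff_distrib)
  finally show "1 / real b ^ 2 \<le> \<bar>digit_sum b w - of_int m\<bar>"
    using b2 by (simp add: pos_divide_le_eq mult.commute)
qed

section \<open>The digits of y inside the concatenated words\<close>

lemma length_word_power [simp]: "length (word_power w m) = m * length w"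
  by (induction m) (auto simp: word_power_def)

lemma nth_word_power_01: "r < 2 * m \<Longrightarrow> word_power [0, 1::nat] m ! r = (if even r then 0 else 1)"
proof (induction m arbitrary: r)
  case (Suc m)
  have "word_power [0, 1::nat] (Suc m) = 0 # 1 # word_power [0, 1] m" by (simp add: word_power_def)
  then show ?case using Suc by (cases r rule: nat.exhaust; cases "r - 1") auto
qed simp

lemma flat_smap_fromN_snth:
  assumes "\<And>i. f i \<noteq> []" "q < length (f (k + i))"
  shows "flat (smap f (fromN k)) !! ((\<Sum>j<i. length (f (k + j))) + q) = f (k + i) ! q"
  using assms(2)
proof (induction i arbitrary: k)
  case 0
  have "smap f (fromN k) = f k ## smap f (fromN (Suc k))" by (subst siterate.code) simp
  then show ?case using 0 assms(1) by simp
next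
  case (Suc i)
  have eq: "smap f (fromN k) = f k ## smap f (fromN (Suc k))" by (subst siterate.code) simp
  have "(\<Sum>j<Suc i. length (f (k + j))) = length (f k) + (\<Sum>j<i. length (f (Suc k + j)))"
    by (subst sum.lessThan_Suc_shift) simp
  then show ?case using Suc.IH[of "Suc k"] Suc.prems assms(1) by (simp add: eq add.assoc)
qed

context
  fixes l :: "nat \<Rightarrow> nat" and \<eta> :: real
  assumes \<eta>: "\<eta> > 1"
    and l_mono: "strict_mono_on {1..} l"
    and gap_nonneg: "\<And>i. i \<ge> 1 \<Longrightarrow> gap l \<eta> i \<ge> 0"
begin

lemma floor_mult_ge: "int (l i) \<le> \<lfloor>real (l i) * \<eta>\<rfloor>"
  using \<eta> mult_left_mono[of 1 \<eta> "real (l i)"] by (simp add: le_floor_iff)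

lemma block_nonempty: "block l \<eta> i \<noteq> []"
  by (simp add: block_def)

lemma l_le: "1 \<le> i \<Longrightarrow> i \<le> j \<Longrightarrow> l i \<le> l j"
  using strict_mono_onD[OF l_mono, of i j] by (cases "i = j") auto

text \<open>The parity split in the word fills exactly the gap. The lengths therefore telescope, and
  word i starts at index \<open>l i - l 1\<close>.\<close>

lemma length_block:
  assumes "i \<ge> 1"
  shows "length (block l \<eta> i) = l (i + 1) - l i"
proof -
  let ?g = "gap l \<eta> i"
  have half: "\<lfloor>real_of_int ?g / 2\<rfloor> = ?g div 2" using floor_divide_of_int_eq[of ?g 2] by simp
  have "int (length (block l \<eta> i)) = \<lfloor>real (l i) * \<eta>\<rfloor> - int (l i) + 1 + 2 * (?g div 2) + (if even ?g then 0 else 1)"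
    using gap_nonneg[OF assms] floor_mult_ge[of i] by (simp add: block_def half)
  also have "2 * (?g div 2) + (if even ?g then 0 else 1) = ?g" by (auto elim!: evenE oddE)
  then have "\<lfloor>real (l i) * \<eta>\<rfloor> - int (l i) + 1 + 2 * (?g div 2) + (if even ?g then 0 else 1) = int (l (i + 1)) - int (l i)"
    by (simp add: gap_def)
  finally show ?thesis by linarith
qed

lemma blocks_concat_snth:
  assumes "i \<ge> 1" "q < length (block l \<eta> i)"
  shows "blocks_concat l \<eta> !! (l i - l 1 + q) = block l \<eta> i ! q"
proof -
  have "(\<Sum>j<n. length (block l \<eta> (1 + j))) = l (n + 1) - l 1" for n
  proof (induction n)
    case (Suc n)
    then show ?case using length_block[of "Suc n"] l_le[of 1 "Suc n"] l_le[of "Suc n" "Suc (Suc n)"] by simp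
  qed simp
  from this[of "i - 1"] show ?thesis
    using flat_smap_fromN_snth[of "block l \<eta>" q 1 "i - 1"] assms block_nonempty
    by (simp add: blocks_concat_def)
qed

text \<open>After its zeros the word reads 1(01)^m = 101...01. The bound on p keeps p + 1 off the
  last letter, since for an odd gap the word ends in 11.\<close>

lemma blocks_concat_alternating:
  fixes i p
  defines "A \<equiv> nat \<lfloor>real (l i) * \<eta>\<rfloor> - l 1"
  assumes i: "i \<ge> 1" and p: "A \<le> p" "p + 2 < l (i + 1) - l 1"
  shows "blocks_concat l \<eta> !! p = 1 \<and> blocks_concat l \<eta> !! Suc p = 0 \<or>
    blocks_concat l \<eta> !! p = 0 \<and> blocks_concat l \<eta> !! Suc p = 1"
proof -
  let ?g = "gap l \<eta> i"
  define n0 where "n0 = nat (\<lfloor>real (l i) * \<eta>\<rfloor> - int (l i))"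
  define m where "m = nat (?g div 2)"
  have half: "\<lfloor>real_of_int ?g / 2\<rfloor> = ?g div 2" using floor_divide_of_int_eq[of ?g 2] by simp
  have block: "block l \<eta> i = word_power [0] n0 @ [1] @ word_power [0, 1] m @ (if even ?g then [] else [1])"
    by (simp add: block_def n0_def m_def half)
  have digit: "block l \<eta> i ! (n0 + q) = (if even q then 1 else 0)" if "q < 1 + 2 * m" for q
  proof (cases q)
    case 0 then show ?thesis by (simp add: block nth_append)
  next
    case (Suc r)
    then show ?thesis using that nth_word_power_01[of r m] by (simp add: block nth_append)
  qed
  have A: "A = l i - l 1 + n0"
    using floor_mult_ge[of i] l_le[of 1 i] i by (simp add: A_def n0_def)
  have B: "l (i + 1) - l 1 \<le> A + 2 * m + 2"
  proof -
    have "?g \<le> 2 * (?g div 2) + 1" by linarith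
    then have "int (l (i + 1)) - \<lfloor>real (l i) * \<eta>\<rfloor> - 1 \<le> 2 * int m + 1"
      using gap_nonneg[OF i] by (simp add: m_def gap_def)
    then show ?thesis unfolding A_def using floor_mult_ge[of i] by linarith
  qed
  define q where "q = p - A"
  have q: "Suc q < 1 + 2 * m" "p = A + q" using p B by (simp_all add: q_def)
  have len: "n0 + 1 + 2 * m \<le> length (block l \<eta> i)" by (simp add: block)
  have "blocks_concat l \<eta> !! (A + r) = (if even r then 1 else 0)" if "r < 1 + 2 * m" for r
    using blocks_concat_snth[OF i, of "n0 + r"] digit[OF that] len that by (simp add: A add.assoc)
  from this[of q] this[of "Suc q"] show ?thesis using q by auto
qed

lemma blocks_concat_far_runs:
  assumes b2: "b \<ge> 2" and digits: "\<And>i. blocks_concat l \<eta> !! i < b"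
    and l_pos: "\<And>i. i \<ge> 1 \<Longrightarrow> l i > 0"
    and l_lim: "(\<lambda>i. real (l (i - 1)) / real (l i)) \<longlonglongrightarrow> 0"
  shows "\<exists>a\<ge>N. \<forall>k. a \<le> k \<and> real k \<le> K * real a \<longrightarrow>
    far (1 / real b ^ 2) (digit_sum b (digit_shift (k\<^sup>2) (snth (blocks_concat l \<eta>))))"
proof -
  \<comment> \<open>From k \<le> K a follows k^2 \<le> K^2 a^2 \<le> 4 K^2 A \<le> 4 K^2 \<eta> l_i;
    the additional 3 l_i covers the offset \<open>l 1\<close> and the margin 2 required by
    \<open>blocks_concat_alternating\<close>.\<close>
  define M where "M = 4 * K\<^sup>2 * \<eta> + 3"
  have "4 * K\<^sup>2 * \<eta> \<ge> 0" using \<eta> by simp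
  then have M: "M > 0" unfolding M_def by linarith
  have "\<forall>\<^sub>F i in sequentially. real (l (i - 1)) / real (l i) < 1 / M"
    by (rule order_tendstoD(2)[OF l_lim]) (use M in simp)
  then obtain I where I: "\<And>i. i \<ge> I \<Longrightarrow> real (l (i - 1)) / real (l i) < 1 / M"
    unfolding eventually_sequentially by blast
  \<comment> \<open>Past I the ratio condition holds; since l_i \<ge> i, the other summands give A
    \<ge> N^2 + 1 and hence a \<ge> N.\<close>
  define i where "i = I + l 1 + N\<^sup>2 + 1"
  have i: "i \<ge> 1" "Suc i \<ge> I" by (auto simp: i_def)
  have growth: "M * real (l i) < real (l (i + 1))"
    using I[OF i(2)] M l_pos[of "Suc i"] by (simp add: divide_less_eq less_divide_eq mult.commute)
  have l_ge: "n \<le> l n" if "n \<ge> 1" for n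
    using that
  proof (induction n rule: dec_induct)
    case base then show ?case using l_pos[of 1] by simp
  next
    case (step n)
    then show ?case using strict_mono_onD[OF l_mono, of n "Suc n"] by auto
  qed
  define A where "A = nat \<lfloor>real (l i) * \<eta>\<rfloor> - l 1"
  have A_ge: "N\<^sup>2 + 1 \<le> A"
    using floor_mult_ge[of i] l_ge[OF i(1)] unfolding A_def i_def by linarith
  have A_le: "real A \<le> real (l i) * \<eta>"
  proof -
    have "real A \<le> real (nat \<lfloor>real (l i) * \<eta>\<rfloor>)" by (simp add: A_def)
    also have "\<dots> \<le> real (l i) * \<eta>" using \<eta> by simp
    finally show ?thesis .
  qed
  \<comment> \<open>The first block beginning beyond A; rounding up at most doubles the root, whence
    the factor 4.\<close>
  define a where "a = Suc (floor_sqrt A)"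
  have "N \<le> floor_sqrt A" using A_ge by (simp add: le_floor_sqrt_iff)
  then have "N \<le> a" by (simp add: a_def)
  have A_less: "A < a\<^sup>2" unfolding a_def by (rule Suc_floor_sqrt_power2_gt)
  have a_sq: "a\<^sup>2 \<le> 4 * A"
  proof -
    have "1 \<le> floor_sqrt A" using A_ge by (simp add: le_floor_sqrt_iff)
    then have "a \<le> 2 * floor_sqrt A" by (simp add: a_def)
    then have "a\<^sup>2 \<le> (2 * floor_sqrt A)\<^sup>2" by (intro power_mono) auto
    also have "\<dots> \<le> 4 * A" using floor_sqrt_power2_le[of A] by (simp add: power_mult_distrib)
    finally show ?thesis .
  qed
  show ?thesis
  proof (intro exI[of _ a] conjI allI impI)
    show "N \<le> a" by fact
    fix k assume k: "a \<le> k \<and> real k \<le> K * real a"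
    let ?p = "k\<^sup>2"
    have "a\<^sup>2 \<le> k\<^sup>2" using k by (intro power_mono) auto
    then have pA: "A \<le> ?p" using A_less by linarith
    have "(real k)\<^sup>2 \<le> (K * real a)\<^sup>2" using k by (intro power_mono) auto
    also have "\<dots> = K\<^sup>2 * real (a\<^sup>2)" by (simp add: power_mult_distrib)
    also have "\<dots> \<le> K\<^sup>2 * real (4 * A)" using a_sq by (intro mult_left_mono) (simp_all only: of_nat_le_iff zero_le_power2)
    also have "\<dots> \<le> 4 * K\<^sup>2 * \<eta> * real (l i)"
    proof -
      have "K\<^sup>2 * 4 * real A \<le> K\<^sup>2 * 4 * (real (l i) * \<eta>)" using A_le by (intro mult_left_mono) auto
      then show ?thesis by (simp add: mult_ac)
    qed
    finally have "real ?p \<le> 4 * K\<^sup>2 * \<eta> * real (l i)" by simp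
    moreover have "1 \<le> real (l i)" using l_pos[OF i(1)] by simp
    moreover have "M * real (l i) = 4 * K\<^sup>2 * \<eta> * real (l i) + 3 * real (l i)"
      by (simp add: M_def distrib_right)
    ultimately have "real ?p + 2 + real (l i) < real (l (i + 1))" using growth by linarith
    then have "?p + 2 + l i < l (i + 1)" by linarith
    then have "?p + 2 < l (i + 1) - l 1" using l_le[of 1 i] i by linarith
    then have "blocks_concat l \<eta> !! ?p = 1 \<and> blocks_concat l \<eta> !! Suc ?p = 0 \<or>
        blocks_concat l \<eta> !! ?p = 0 \<and> blocks_concat l \<eta> !! Suc ?p = 1"
      using blocks_concat_alternating[OF i(1) pA[unfolded A_def]] by blast
    then show "far (1 / real b ^ 2) (digit_sum b (digit_shift ?p (snth (blocks_concat l \<eta>))))"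
      by (intro far_if_digits_01[OF b2]) (auto simp: digit_shift_def digits)
  qed
qed

end

section \<open>The bivariate spectrum\<close>

lemma levy_eq_levy_translated: "levy b \<alpha> = levy_translated b \<alpha> 0"
  by (simp add: fun_eq_iff levy_def levy_translated_def)

theorem proposition2p7:
  fixes b :: nat and \<alpha>1 \<alpha>2 \<eta> y H1 H2 :: real and l :: "nat \<Rightarrow> nat"
  assumes "b \<ge> 2" and "\<alpha>1 > 0" and "\<alpha>2 > 0" and "\<eta> > 1"
    and "\<And>i. i \<ge> 1 \<Longrightarrow> l i > 0"
    and "strict_mono_on {1..} l"
    and "(\<lambda>i. real (l (i - 1)) / real (l i)) \<longlonglongrightarrow> 0"
    and "\<And>i. i \<ge> 1 \<Longrightarrow> gap l \<eta> i \<ge> 0"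
    and "has_expansion b y (blocks_concat l \<eta>)"
  shows "bivariate_spectrum (levy b \<alpha>1) (levy_translated b \<alpha>2 y) H1 H2 =
    (if (H1, H2) \<in> {0..\<alpha>1} \<times> {0..\<alpha>2} then ereal (min (H1 / \<alpha>1) (H2 / \<alpha>2)) else - \<infinity>)"
proof -
  let ?L1 = "levy_translated b \<alpha>1 0" and ?L2 = "levy_translated b \<alpha>2 y"
  define T where "T = {x. holder_exponent ?L1 x = ereal H1 \<and> holder_exponent ?L2 x = ereal H2}"
  have spectrum: "bivariate_spectrum (levy b \<alpha>1) ?L2 H1 H2 = hausdorff_dim T"
    by (simp add: bivariate_spectrum_def levy_eq_levy_translated T_def)
  show ?thesis
  proof (cases "(H1, H2) \<in> {0..\<alpha>1} \<times> {0..\<alpha>2}")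
    case False
    have "T = {}"
    proof (rule ccontr)
      assume "T \<noteq> {}"
      then obtain x where "holder_exponent ?L1 x = ereal H1" "holder_exponent ?L2 x = ereal H2"
        by (auto simp: T_def)
      then show False
        using False holder_exponent_levy_bounds[OF assms(1,2), of 0 x]
          holder_exponent_levy_bounds[OF assms(1,3), of y x] by auto
    qed
    then show ?thesis unfolding spectrum if_not_P[OF False] by (simp add: hausdorff_dim_def)
  next
    case True
    define \<zeta> where "\<zeta> = snth (blocks_concat l \<eta>)"
    define u v where "u = H1 / \<alpha>1" and "v = H2 / \<alpha>2"
    have uv: "0 \<le> u" "u \<le> 1" "0 \<le> v" "v \<le> 1" and H: "\<alpha>1 * u = H1" "\<alpha>2 * v = H2"
      using True assms by (auto simp: u_def v_def)
    have \<zeta>_less: "\<zeta> i < b" and y: "y = digit_sum b \<zeta>" for i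
      using assms(9) by (auto simp: has_expansion_def \<zeta>_def digit_sum_def sums_iff)
    have far_runs: "\<exists>a\<ge>N. \<forall>k. a \<le> k \<and> real k \<le> K * real a \<longrightarrow>
        far (1 / real b ^ 2) (digit_sum b (digit_shift (k\<^sup>2) \<zeta>))" for K N
      unfolding \<zeta>_def
      by (rule blocks_concat_far_runs[OF assms(4,6,8,1) \<zeta>_less[unfolded \<zeta>_def] assms(5,7)])
    obtain \<rho> a c where "digit_runs b \<zeta> u v (1 / real b ^ 2) \<rho> a c"
      using exists_digit_runs[OF assms(1) \<zeta>_less uv _ far_runs] assms(1) by auto
    then interpret digit_runs b \<zeta> u v "1 / real b ^ 2" \<rho> a c .
    \<comment> \<open>Index 0 compares x with 0 and index 1 compares it with y; their parities
      select the rates u and v.\<close>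
    have in_T: "digit_sum b w \<in> T" if w: "admissible w" for w
    proof -
      have "holder_exponent ?L1 (digit_sum b w) = ereal (\<alpha>1 * u)"
        using admissible_well_approx[OF w, of _ 0] admissible_badly_approx[OF w, of _ 0] assms uv
        by (intro holder_exponent_levy) (auto simp: model_def)
      moreover have "holder_exponent ?L2 (digit_sum b w) = ereal (\<alpha>2 * v)"
        using admissible_well_approx[OF w, of _ 1] admissible_badly_approx[OF w, of _ 1] assms uv
        by (intro holder_exponent_levy) (auto simp: model_def y)
      ultimately show ?thesis by (simp add: T_def H)
    qed
    have "hausdorff_dim T = ereal (min u v)"
    proof (rule hausdorff_dim_eqI)
      \<comment> \<open>Filling the free positions by \<open>fixed_digit\<close> as well gives a
        point of T; it makes the dimension 0 rather than - \<infinity> when min u v = 0.\<close>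
      have "admissible fixed_digit" by (simp add: admissible_def fixed_digit_less)
      then show "T \<noteq> {}" using in_T by blast
      show "0 \<le> min u v" using uv by simp
    next
      fix s assume s: "min u v < s"
      have null: "hausdorff_measure s T = 0"
        if t: "0 \<le> t" "t < s" "\<alpha> > 0" "\<And>x. x \<in> T \<Longrightarrow> holder_exponent (levy_translated b \<alpha> z) x = ereal (\<alpha> * t)"
        for t \<alpha> z
      proof -
        \<comment> \<open>\<open>1 / \<tau>\<close> is the midpoint of t and s: the points of T are
          still approximated with exponent \<tau>, while s \<tau> > 1 makes the set of such points
          null.\<close>
        define \<tau> where "\<tau> = 2 / (s + t)"
        have \<tau>: "\<tau> > 0" "s * \<tau> > 1" "t * \<tau> < 1"
          using t by (auto simp: \<tau>_def pos_less_divide_eq pos_divide_less_eq)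
        have "\<alpha> * t * \<tau> < \<alpha>" using \<tau>(3) t(3) by (simp add: mult.assoc)
        then have "T \<subseteq> {x. well_approx b \<tau> (x - z)}"
          using well_approx_if_holder_exponent[OF assms(1) t(3) \<tau>(1)] t(4) by blast
        then have "hausdorff_measure s T \<le> hausdorff_measure s {x. well_approx b \<tau> (x - z)}"
          by (rule hausdorff_measure_mono)
        then show ?thesis using hausdorff_measure_well_approx[OF assms(1) _ \<tau>(1,2), of z] t by simp
      qed
      from s consider "u < s" | "v < s" by linarith
      then show "hausdorff_measure s T = 0"
      proof cases
        case 1 then show ?thesis by (intro null[of u \<alpha>1 0]) (use uv assms H in \<open>auto simp: T_def\<close>)
      next
        case 2 then show ?thesis by (intro null[of v \<alpha>2 y]) (use uv assms H in \<open>auto simp: T_def\<close>)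
      qed
    next
      fix s assume s: "0 < s" "s < min u v"
      obtain N0 where "\<And>n. n \<ge> N0 \<Longrightarrow> s * real n \<le> real (free_count fixed_positions n)"
        using fixed_positions_sparse[OF s(2)] by blast
      then show "hausdorff_measure s T \<noteq> 0"
        by (rule hausdorff_measure_digit_set_pos[OF assms(1), where d = fixed_digit, OF fixed_digit_less s(1)])
          (auto intro: in_T simp: admissible_def)
    qed
    then show ?thesis using True by (simp add: spectrum u_def v_def)
  qed
qed

end
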